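(* Let $(S,g,t)$ be a statistical manifold related to an exponential family, equipped with its Fisher--Rao metric $g$ and its skewness tensor $t$. For $\alpha\in\mathbb{R}$ let $\overset{\alpha}{\nabla}$ be the structure connection $$\overset{\alpha}{\nabla}_XY=\overset{0}{\nabla}_XY+\frac{\alpha}{2}\,(X\circ Y),$$ where $\circ$ is the multiplication on $TS$ determined by $g(X\circ Y,Z)=t(X,Y,Z)$. Then $(S,g,t)$, with structure connection $\overset{\alpha}{\nabla}$, is a Frobenius manifold for $\alpha=\pm1$, and only for these values of $\alpha$.
   Context: Statistical manifold. Let $(\Omega,\mathcal{F},\lambda)$ be a measure space with $\lambda$ $\sigma$-finite. $S$ is a family of probability densities $\rho_\theta=dP_\theta/d\lambda\in L^1(\Omega,\lambda)$, $\theta=(\theta_1,\dots,\theta_n)$, with $\rho_\theta>0$ $\lambda$-a.e. and $\int_\Omega\rho_\theta\,d\lambda=1$, assumed to be a smooth manifold. Put $\ell_\theta=\ln\rho_\theta$ and $\partial_i=\partial/\partial\theta_i$. The tangent space $T_{\rho_\theta}S$ is identified with the $n$-dimensional space of centred random variables in $L^2(\Omega,P_\theta)$ spanned by the scores $\partial_i\ell_\theta$. Standing assumptions. The statistical manifolds considered are related to exponential families (i.e. the densities have the form $\rho_\beta=\exp\{-\sum_{j=0}^n\beta^jX_j\}$ with $X_0\equiv1$, with $X_0,X_1,\dots,X_n$ linearly independent random variables, the coefficient $\beta^0$ being fixed by normalization, and $\beta$ the canonical affine parameters). They are totally geodesic maximal submanifolds in the sense of Chentsov, and their metrics are Markov invariant.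 Metric, skewness tensor, multiplication. The Fisher--Rao metric is $g_{ij}(\theta)=\mathbb{E}_{P_\theta}[\partial_i\ell_\theta\,\partial_j\ell_\theta]$, with inverse matrix $g^{ij}$. The skewness tensor is the fully symmetric covariant 3-tensor $t(u,v,w)|_{\rho_\theta}=\mathbb{E}_{P_\theta}[u_\theta v_\theta w_\theta]$, with components $t_{ijk}=\mathbb{E}_{P_\theta}[\partial_i\ell_\theta\,\partial_j\ell_\theta\,\partial_k\ell_\theta]$. The multiplication is $u\circ v=\overline{t}(u,v)$ with $\overline{t}^{\,k}_{ij}=\sum_m g^{km}t_{ijm}$. $\overset{0}{\nabla}$ is the Levi-Civita connection of $g$. Frobenius manifold (definition used here). A pre-Frobenius manifold is a manifold $M$ with an affine flat structure (an atlas whose transition functions are affine linear), a compatible metric $g$, an even symmetric rank 3 tensor $t$, and a symmetric bilinear multiplication $\circ:TM\otimes TM\to TM$. It is Frobenius if the following two conditions hold. (Associativity) For all (flat) local tangent fields $u,v,w$, $t(u,v,w)=g(u\circ v,w)=g(u,v\circ w)$. (Potentiality) Locally everywhere there is a function $\Phi$ with $t(\partial_a,\partial_b,\partial_c)=\partial_a\partial_b\partial_c\Phi$ for the flat local tangent fields $\partial_a$. Here, for $(S,g,t)$ with structure connection $\overset{\alpha}{\nabla}$, the affine flat structure is the one given by $\overset{\alpha}{\nabla}$: the connection $\overset{\alpha}{\nabla}$ is required to be flat and torsion-free, and the flat fields $\partial_a$ are the coordinate fields of local $\overset{\alpha}{\nabla}$-affine coordinates.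
   Formalization: "Only for these values" is proved when the Levi-Civita connection of g is not flat (if flat, e.g. n=1 or Gaussian location families, every α is Frobenius); such S exist in every dimension n≥2. "Compatible metric" is read as the Codazzi condition. *)

theory Defs
  imports "HOL-Analysis.Analysis"
begin

section \<open>Smooth maps and vector fields on open subsets of Euclidean space\<close>

primrec times_differentiable_on ::
  "nat \<Rightarrow> ('a::real_normed_vector \<Rightarrow> 'b::real_normed_vector) \<Rightarrow> 'a set \<Rightarrow> bool" where
  "times_differentiable_on 0 f U \<longleftrightarrow> continuous_on U f"
| "times_differentiable_on (Suc k) f U \<longleftrightarrow>
     (\<forall>p\<in>U. f differentiable (at p)) \<and>
     (\<forall>v. times_differentiable_on k (\<lambda>p. frechet_derivative f (at p) v) U)"

text \<open>Of class $C^\infty$; only meant for open sets.\<close>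

definition smooth_on :: "'a::real_normed_vector set \<Rightarrow> ('a \<Rightarrow> 'b::real_normed_vector) \<Rightarrow> bool" where
  "smooth_on U f \<longleftrightarrow> (\<forall>k. times_differentiable_on k f U)"

text \<open>All manifolds below carry a global chart, so a manifold is an open set \<open>\<Theta>\<close> in a coordinate
  space, tangent vectors and vector fields are given by their components in that chart, and an
  affine connection is an operator \<open>nab X Y\<close> on vector fields.\<close>

type_synonym 'n field = "real^'n \<Rightarrow> real^'n"
type_synonym 'n metric = "real^'n \<Rightarrow> real^'n \<Rightarrow> real^'n \<Rightarrow> real"
type_synonym 'n tensor3 = "real^'n \<Rightarrow> real^'n \<Rightarrow> real^'n \<Rightarrow> real^'n \<Rightarrow> real"
type_synonym 'n product = "real^'n \<Rightarrow> real^'n \<Rightarrow> real^'n \<Rightarrow> real^'n"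
type_synonym 'n connection = "'n field \<Rightarrow> 'n field \<Rightarrow> 'n field"

text \<open>The derivative of \<open>f\<close> along the field \<open>X\<close>, for scalar or vector-valued \<open>f\<close>.\<close>

definition along :: "('n::finite) field \<Rightarrow> (real^'n \<Rightarrow> 'b::real_normed_vector) \<Rightarrow> real^'n \<Rightarrow> 'b" where
  "along X f p = frechet_derivative f (at p) (X p)"

definition lie_bracket :: "('n::finite) field \<Rightarrow> 'n field \<Rightarrow> 'n field" where
  "lie_bracket X Y p = along X Y p - along Y X p"

section \<open>Metrics, tensors and connections\<close>

definition riemannian_metric_on :: "(real^('n::finite)) set \<Rightarrow> 'n metric \<Rightarrow> bool" where
  "riemannian_metric_on \<Theta> g \<longleftrightarrow>
     (\<forall>p\<in>\<Theta>. bilinear (g p) \<and> (\<forall>u v. g p u v = g p v u) \<and> (\<forall>u. u \<noteq> 0 \<longrightarrow> g p u u > 0)) \<and>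
     (\<forall>u v. smooth_on \<Theta> (\<lambda>p. g p u v))"

definition symmetric_tensor3_on :: "(real^('n::finite)) set \<Rightarrow> 'n tensor3 \<Rightarrow> bool" where
  "symmetric_tensor3_on \<Theta> t \<longleftrightarrow>
     (\<forall>p\<in>\<Theta>. \<forall>u v w. linear (\<lambda>z. t p z v w) \<and> t p u v w = t p v u w \<and> t p u v w = t p u w v) \<and>
     (\<forall>u v w. smooth_on \<Theta> (\<lambda>p. t p u v w))"

definition symmetric_product_on :: "(real^('n::finite)) set \<Rightarrow> 'n product \<Rightarrow> bool" where
  "symmetric_product_on \<Theta> m \<longleftrightarrow>
     (\<forall>p\<in>\<Theta>. bilinear (m p) \<and> (\<forall>u v. m p u v = m p v u)) \<and>
     (\<forall>u v. smooth_on \<Theta> (\<lambda>p. m p u v))"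

definition affine_connection_on :: "(real^('n::finite)) set \<Rightarrow> 'n connection \<Rightarrow> bool" where
  "affine_connection_on \<Theta> nab \<longleftrightarrow>
     (\<forall>U X X' Y Y' f. open U \<longrightarrow> U \<subseteq> \<Theta> \<longrightarrow> smooth_on U X \<longrightarrow> smooth_on U X' \<longrightarrow>
        smooth_on U Y \<longrightarrow> smooth_on U Y' \<longrightarrow> smooth_on U (f :: real^'n \<Rightarrow> real) \<longrightarrow>
        smooth_on U (nab X Y) \<and>
        (\<forall>p\<in>U. nab (\<lambda>q. X q + X' q) Y p = nab X Y p + nab X' Y p \<and>
               nab (\<lambda>q. f q *\<^sub>R X q) Y p = f p *\<^sub>R nab X Y p \<and>
               nab X (\<lambda>q. Y q + Y' q) p = nab X Y p + nab X Y' p \<and>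
               nab X (\<lambda>q. f q *\<^sub>R Y q) p = along X f p *\<^sub>R Y p + f p *\<^sub>R nab X Y p))"

definition torsion :: "('n::finite) connection \<Rightarrow> 'n field \<Rightarrow> 'n field \<Rightarrow> 'n field" where
  "torsion nab X Y p = nab X Y p - nab Y X p - lie_bracket X Y p"

definition curvature :: "('n::finite) connection \<Rightarrow> 'n field \<Rightarrow> 'n field \<Rightarrow> 'n field \<Rightarrow> 'n field" where
  "curvature nab X Y Z p = nab X (nab Y Z) p - nab Y (nab X Z) p - nab (lie_bracket X Y) Z p"

definition torsion_free_on :: "(real^('n::finite)) set \<Rightarrow> 'n connection \<Rightarrow> bool" where
  "torsion_free_on \<Theta> nab \<longleftrightarrow>
     (\<forall>X Y. smooth_on \<Theta> X \<longrightarrow> smooth_on \<Theta> Y \<longrightarrow> (\<forall>p\<in>\<Theta>. torsion nab X Y p = 0))"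

definition flat_on :: "(real^('n::finite)) set \<Rightarrow> 'n connection \<Rightarrow> bool" where
  "flat_on \<Theta> nab \<longleftrightarrow>
     (\<forall>X Y Z. smooth_on \<Theta> X \<longrightarrow> smooth_on \<Theta> Y \<longrightarrow> smooth_on \<Theta> Z \<longrightarrow>
        (\<forall>p\<in>\<Theta>. curvature nab X Y Z p = 0))"

text \<open>\<open>gram g p\<close> is the matrix $(g_{ij})$; the matrix $(g^{ij})$ is its inverse.\<close>

definition gram :: "('n::finite) metric \<Rightarrow> real^'n \<Rightarrow> real^'n^'n" where
  "gram g p = (\<chi> i j. g p (axis i 1) (axis j 1))"

text \<open>The Levi-Civita connection, with the Christoffel symbols
  $\Gamma^k_{ij} = \frac12 \sum_m g^{km}(\partial_i g_{jm} + \partial_j g_{im} - \partial_m g_{ij})$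
  extended bilinearly in the two lower indices to tangent vectors \<open>u\<close>, \<open>v\<close>.\<close>

definition christoffel :: "('n::finite) metric \<Rightarrow> 'n product" where
  "christoffel g p u v = matrix_inv (gram g p) *v (\<chi> m. (1/2) *
     (frechet_derivative (\<lambda>q. g q v (axis m 1)) (at p) u
      + frechet_derivative (\<lambda>q. g q u (axis m 1)) (at p) v
      - frechet_derivative (\<lambda>q. g q u v) (at p) (axis m 1)))"

definition levi_civita :: "('n::finite) metric \<Rightarrow> 'n connection" where
  "levi_civita g X Y p = along X Y p + christoffel g p (X p) (Y p)"

section \<open>Affine flat structures and Frobenius manifolds\<close>

definition coord_field :: "(real^('n::finite) \<Rightarrow> real^'n) \<Rightarrow> 'n \<Rightarrow> 'n field" where
  "coord_field x a p = inv (frechet_derivative x (at p)) (axis a 1)"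

text \<open>Local \<open>nab\<close>-affine coordinates \<open>x\<close> on \<open>U\<close>: by the inverse function theorem the conditions on
  \<open>x\<close> say that it is a diffeomorphism onto an open set, and its coordinate fields are required to
  be parallel. The transition maps between two such charts are locally affine.\<close>

definition affine_chart_on ::
  "(real^('n::finite)) set \<Rightarrow> 'n connection \<Rightarrow> (real^'n) set \<Rightarrow> (real^'n \<Rightarrow> real^'n) \<Rightarrow> bool" where
  "affine_chart_on \<Theta> nab U x \<longleftrightarrow>
     open U \<and> U \<subseteq> \<Theta> \<and> smooth_on U x \<and> inj_on x U \<and>
     (\<forall>p\<in>U. bij (frechet_derivative x (at p))) \<and>
     (\<forall>p\<in>U. \<forall>a b. nab (coord_field x a) (coord_field x b) p = 0)"

definition affine_flat_structure_on :: "(real^('n::finite)) set \<Rightarrow> 'n connection \<Rightarrow> bool" where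
  "affine_flat_structure_on \<Theta> nab \<longleftrightarrow>
     affine_connection_on \<Theta> nab \<and> torsion_free_on \<Theta> nab \<and> flat_on \<Theta> nab \<and>
     (\<forall>p\<in>\<Theta>. \<exists>U x. p \<in> U \<and> affine_chart_on \<Theta> nab U x)"

text \<open>The metric is compatible with the affine structure in the sense of Codazzi, that is, the
  covariant derivative of \<open>g\<close> is totally symmetric. It is not required to be parallel: no
  Fisher metric would then qualify unless it were flat.\<close>

definition metric_derivative ::
  "('n::finite) connection \<Rightarrow> 'n metric \<Rightarrow> 'n field \<Rightarrow> 'n field \<Rightarrow> 'n field \<Rightarrow> real^'n \<Rightarrow> real" where
  "metric_derivative nab g X Y Z p =
     along X (\<lambda>q. g q (Y q) (Z q)) p - g p (nab X Y p) (Z p) - g p (Y p) (nab X Z p)"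

definition compatible_metric_on :: "(real^('n::finite)) set \<Rightarrow> 'n connection \<Rightarrow> 'n metric \<Rightarrow> bool" where
  "compatible_metric_on \<Theta> nab g \<longleftrightarrow> riemannian_metric_on \<Theta> g \<and>
     (\<forall>X Y Z. smooth_on \<Theta> X \<longrightarrow> smooth_on \<Theta> Y \<longrightarrow> smooth_on \<Theta> Z \<longrightarrow>
        (\<forall>p\<in>\<Theta>. metric_derivative nab g X Y Z p = metric_derivative nab g Y X Z p))"

definition pre_frobenius_manifold ::
  "(real^('n::finite)) set \<Rightarrow> 'n connection \<Rightarrow> 'n metric \<Rightarrow> 'n tensor3 \<Rightarrow> 'n product \<Rightarrow> bool" where
  "pre_frobenius_manifold \<Theta> nab g t m \<longleftrightarrow>
     open \<Theta> \<and> affine_flat_structure_on \<Theta> nab \<and> compatible_metric_on \<Theta> nab g \<and>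
     symmetric_tensor3_on \<Theta> t \<and> symmetric_product_on \<Theta> m"

definition associativity_on ::
  "(real^('n::finite)) set \<Rightarrow> 'n metric \<Rightarrow> 'n tensor3 \<Rightarrow> 'n product \<Rightarrow> bool" where
  "associativity_on \<Theta> g t m \<longleftrightarrow>
     (\<forall>p\<in>\<Theta>. \<forall>u v w. t p u v w = g p (m p u v) w \<and> t p u v w = g p u (m p v w))"

definition potentiality_on :: "(real^('n::finite)) set \<Rightarrow> 'n connection \<Rightarrow> 'n tensor3 \<Rightarrow> bool" where
  "potentiality_on \<Theta> nab t \<longleftrightarrow>
     (\<forall>U x. affine_chart_on \<Theta> nab U x \<longrightarrow>
        (\<forall>p\<in>U. \<exists>V \<Phi>. open V \<and> p \<in> V \<and> V \<subseteq> U \<and> smooth_on V (\<Phi> :: real^'n \<Rightarrow> real) \<and>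
           (\<forall>q\<in>V. \<forall>a b c.
              t q (coord_field x a q) (coord_field x b q) (coord_field x c q) =
              along (coord_field x a) (along (coord_field x b) (along (coord_field x c) \<Phi>)) q)))"

definition frobenius_manifold ::
  "(real^('n::finite)) set \<Rightarrow> 'n connection \<Rightarrow> 'n metric \<Rightarrow> 'n tensor3 \<Rightarrow> 'n product \<Rightarrow> bool" where
  "frobenius_manifold \<Theta> nab g t m \<longleftrightarrow>
     pre_frobenius_manifold \<Theta> nab g t m \<and> associativity_on \<Theta> g t m \<and> potentiality_on \<Theta> nab t"

section \<open>Statistical manifolds of exponential families\<close>

definition natural_domain :: "'a measure \<Rightarrow> ('n::finite \<Rightarrow> 'a \<Rightarrow> real) \<Rightarrow> (real^'n) set" where
  "natural_domain M X = {\<beta>. integrable M (\<lambda>\<omega>. exp (- (\<Sum>j\<in>UNIV. \<beta> $ j * X j \<omega>)))}"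

text \<open>The maximal open set of canonical affine parameters, used as global chart.\<close>

definition parameters :: "'a measure \<Rightarrow> ('n::finite \<Rightarrow> 'a \<Rightarrow> real) \<Rightarrow> (real^'n) set" where
  "parameters M X = interior (natural_domain M X)"

text \<open>\<open>M\<close> is the dominating measure $\lambda$. Linear independence of $1, X_1, \dots, X_n$ is
  independence as random variables, that is, modulo null sets.\<close>

definition exponential_family :: "'a measure \<Rightarrow> ('n::finite \<Rightarrow> 'a \<Rightarrow> real) \<Rightarrow> bool" where
  "exponential_family M X \<longleftrightarrow>
     sigma_finite_measure M \<and> (\<forall>j. X j \<in> borel_measurable M) \<and>
     (\<forall>c\<^sub>0 (c :: real^'n). (AE \<omega> in M. c\<^sub>0 + (\<Sum>j\<in>UNIV. c $ j * X j \<omega>) = 0) \<longrightarrow> c\<^sub>0 = 0 \<and> c = 0) \<and>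
     parameters M X \<noteq> {}"

text \<open>The coefficient $\beta^0$ of $X_0 \equiv 1$, fixed by normalization of the density.\<close>

definition log_partition :: "'a measure \<Rightarrow> ('n::finite \<Rightarrow> 'a \<Rightarrow> real) \<Rightarrow> real^'n \<Rightarrow> real" where
  "log_partition M X \<beta> = ln (\<integral>\<omega>. exp (- (\<Sum>j\<in>UNIV. \<beta> $ j * X j \<omega>)) \<partial>M)"

definition rho :: "'a measure \<Rightarrow> ('n::finite \<Rightarrow> 'a \<Rightarrow> real) \<Rightarrow> real^'n \<Rightarrow> 'a \<Rightarrow> real" where
  "rho M X \<beta> \<omega> = exp (- (log_partition M X \<beta> + (\<Sum>j\<in>UNIV. \<beta> $ j * X j \<omega>)))"

definition prob_at :: "'a measure \<Rightarrow> ('n::finite \<Rightarrow> 'a \<Rightarrow> real) \<Rightarrow> real^'n \<Rightarrow> 'a measure" where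
  "prob_at M X \<beta> = density M (\<lambda>\<omega>. ennreal (rho M X \<beta> \<omega>))"

text \<open>The random variable $\sum_i u_i\, \partial_i \ell_\beta$ representing the tangent vector \<open>u\<close>.\<close>

definition score :: "'a measure \<Rightarrow> ('n::finite \<Rightarrow> 'a \<Rightarrow> real) \<Rightarrow> real^'n \<Rightarrow> real^'n \<Rightarrow> 'a \<Rightarrow> real" where
  "score M X \<beta> u \<omega> = frechet_derivative (\<lambda>\<theta>. ln (rho M X \<theta> \<omega>)) (at \<beta>) u"

definition fisher_rao :: "'a measure \<Rightarrow> ('n::finite \<Rightarrow> 'a \<Rightarrow> real) \<Rightarrow> 'n metric" where
  "fisher_rao M X \<beta> u v = (\<integral>\<omega>. score M X \<beta> u \<omega> * score M X \<beta> v \<omega> \<partial>prob_at M X \<beta>)"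

definition skewness :: "'a measure \<Rightarrow> ('n::finite \<Rightarrow> 'a \<Rightarrow> real) \<Rightarrow> 'n tensor3" where
  "skewness M X \<beta> u v w =
     (\<integral>\<omega>. score M X \<beta> u \<omega> * score M X \<beta> v \<omega> * score M X \<beta> w \<omega> \<partial>prob_at M X \<beta>)"

text \<open>The product with components $\overline{t}^{\,k}_{ij} = \sum_m g^{km} t_{ijm}$.\<close>

definition stat_product :: "'a measure \<Rightarrow> ('n::finite \<Rightarrow> 'a \<Rightarrow> real) \<Rightarrow> 'n product" where
  "stat_product M X \<beta> u v =
     matrix_inv (gram (fisher_rao M X) \<beta>) *v (\<chi> m. skewness M X \<beta> u v (axis m 1))"

definition structure_connection ::
  "'a measure \<Rightarrow> ('n::finite \<Rightarrow> 'a \<Rightarrow> real) \<Rightarrow> real \<Rightarrow> 'n connection" where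
  "structure_connection M X \<alpha> Y Z \<beta> =
     levi_civita (fisher_rao M X) Y Z \<beta> + (\<alpha> / 2) *\<^sub>R stat_product M X \<beta> (Y \<beta>) (Z \<beta>)"

definition statistical_frobenius ::
  "'a measure \<Rightarrow> ('n::finite \<Rightarrow> 'a \<Rightarrow> real) \<Rightarrow> real \<Rightarrow> bool" where
  "statistical_frobenius M X \<alpha> \<longleftrightarrow>
     frobenius_manifold (parameters M X) (structure_connection M X \<alpha>)
       (fisher_rao M X) (skewness M X) (stat_product M X)"

end

theory Submission
  imports Defs
begin

text \<open>In the canonical parameters \<open>\<beta>\<close> the log-partition function \<open>\<psi>\<close> generates the moments of
  the scores: $g_{ij} = \partial_i\partial_j\psi$ and $t_{ijk} = \partial_i\partial_j\partial_k\psi$.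
  So \<open>g\<close> is a Hessian metric, its Christoffel symbols of the first kind are
  $\frac12\,t_{ijk}$, and the structure connections are the line of connections
  $\nabla^\alpha_X Y = D_X Y + s\,(X \circ Y)$ with $s = \frac{1+\alpha}{2}$, where \<open>D\<close>
  differentiates in the chart \<open>\<beta>\<close>.

  Curvature along this line is a polynomial in \<open>s\<close> of degree two. It vanishes at $s = 0$, where the
  connection is \<open>D\<close>, and at $s = 1$: since $D_X g = t(X,\cdot,\cdot)$, the Gram matrix \<open>G\<close>
  intertwines the two, $G\,\nabla^1_X Y = D_X (G Y)$ (lemma \<open>along_gram\<close>). Hence the curvature of
  $\nabla^\alpha$ is $\frac{\alpha^2-1}{4}\,[X\circ, Y\circ]$ (lemma \<open>curvature_alpha_connection\<close>).
  If a parameter other than $\pm 1$ gave a flat connection, the commutators would vanish and the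
  Levi-Civita connection, $\alpha = 0$, would be flat too. This is the \<open>only\<close> part.

  For $\alpha = -1$ the flat fields are locally constant in \<open>\<beta>\<close>, so that \<open>\<psi>\<close> itself is a potential of
  \<open>t\<close>. For $\alpha = 1$ the covectors $G\,e_a$ of flat fields are locally constant, affine
  coordinates are given by the gradient of \<open>\<psi>\<close>, and the potential is
  $\psi(\beta) - \beta\cdot\nabla\psi(\beta)$, the Legendre transform of \<open>\<psi>\<close> up to sign. The metric
  is Codazzi for every \<open>\<alpha>\<close> because $\nabla^\alpha g = -\alpha\,t$.

  Differentiation under the integral sign is uniform over one class of integrands, those
  that grow more slowly than every $e^{r|T|}$, \<open>T\<close> being the sufficient statistic: the class contains
  the polynomials in \<open>T\<close> and is closed under products, so smoothness follows by induction from a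
  single derivative (lemma \<open>moment_has_derivative\<close>).

  A family that is not flat in any dimension \<open>n \<ge> 2\<close> consists of all positive distributions on
  \<open>n + 1\<close> points. There every centred random variable is a score, the product of two scores is their
  pointwise product minus its mean, and $[u\circ, v\circ]w = g(u,w)\,v - g(v,w)\,u$; the metric is
  that of a sphere.\<close>

section \<open>Calculus of smooth maps\<close>

abbreviation pd :: "'a::real_normed_vector \<Rightarrow> ('a \<Rightarrow> 'b::real_normed_vector) \<Rightarrow> 'a \<Rightarrow> 'b" where
  "pd v f p \<equiv> frechet_derivative f (at p) v"

lemma has_frechet_derivative:
  "f differentiable (at p) \<Longrightarrow> (f has_derivative frechet_derivative f (at p)) (at p)"
  using frechet_derivative_works by blast

lemma pd_eqI: "(f has_derivative f') (at p) \<Longrightarrow> pd v f p = f' v"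
  using frechet_derivative_at by metis

text \<open>Functions that agree near a point have the same set of candidates for a derivative there, be it
  empty or not, so the choice operator in \<open>frechet_derivative\<close> picks the same one.\<close>

lemma frechet_derivative_cong_open:
  assumes "open U" "p \<in> U" "\<And>q. q \<in> U \<Longrightarrow> f q = g q"
  shows "frechet_derivative f (at p) = frechet_derivative g (at p)"
proof -
  have "(f has_derivative f') (at p) \<longleftrightarrow> (g has_derivative f') (at p)" for f'
    using assms has_derivative_transform_within_open[of f f' p UNIV U g]
      has_derivative_transform_within_open[of g f' p UNIV U f] by auto
  then show ?thesis by (simp add: frechet_derivative_def)
qed

lemma along_cong_open:
  assumes "open U" "p \<in> U" "\<And>q. q \<in> U \<Longrightarrow> f q = g q"
  shows "along X f p = along X g p"
  using frechet_derivative_cong_open[OF assms] by (simp add: along_def)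

lemma pd_bounded_linear:
  assumes "bounded_linear L" "f differentiable (at p)"
  shows "pd v (\<lambda>q. L (f q)) p = L (pd v f p)"
  by (rule pd_eqI)
     (rule bounded_linear.has_derivative[OF assms(1) has_frechet_derivative[OF assms(2)]])

lemma pd_bounded_bilinear:
  assumes "bounded_bilinear B" "f differentiable (at p)" "g differentiable (at p)"
  shows "pd v (\<lambda>q. B (f q) (g q)) p = B (f p) (pd v g p) + B (pd v f p) (g p)"
  by (rule pd_eqI)
     (rule bounded_bilinear.FDERIV[OF assms(1) has_frechet_derivative[OF assms(2)]
        has_frechet_derivative[OF assms(3)]])

lemma times_differentiable_on_cong:
  assumes "open U"
  shows "\<lbrakk>\<And>p. p \<in> U \<Longrightarrow> f p = g p; times_differentiable_on k f U\<rbrakk> \<Longrightarrow> times_differentiable_on k g U"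
proof (induction k arbitrary: f g)
  case 0
  then show ?case using continuous_on_cong[of U U f g] by simp
next
  case (Suc k)
  have "g differentiable (at p)" if "p \<in> U" for p
  proof -
    have "(f has_derivative frechet_derivative f (at p)) (at p)"
      using Suc.prems(2) that by (intro has_frechet_derivative) simp
    then have "(g has_derivative frechet_derivative f (at p)) (at p)"
      using has_derivative_transform_within_open[of f _ p UNIV U g] assms that Suc.prems(1) by blast
    then show ?thesis by (rule differentiableI)
  qed
  moreover have "times_differentiable_on k (pd v g) U" for v
  proof (rule Suc.IH[of "pd v f"])
    show "pd v f p = pd v g p" if "p \<in> U" for p
      using frechet_derivative_cong_open[OF assms that Suc.prems(1)] by simp
    show "times_differentiable_on k (pd v f) U" using Suc.prems(2) by simp
  qed
  ultimately show ?case by simp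
qed

lemma times_differentiable_on_subset:
  "\<lbrakk>V \<subseteq> U; times_differentiable_on k f U\<rbrakk> \<Longrightarrow> times_differentiable_on k f V"
  by (induction k arbitrary: f) (auto intro: continuous_on_subset)

lemma times_differentiable_on_SucD: "times_differentiable_on (Suc k) f U \<Longrightarrow> times_differentiable_on k f U"
proof (induction k arbitrary: f)
  case 0
  then show ?case
    by (auto intro!: continuous_at_imp_continuous_on differentiable_imp_continuous_within)
next
  case (Suc k)
  then show ?case by (metis times_differentiable_on.simps(2))
qed

lemma times_differentiable_on_const: "times_differentiable_on k (\<lambda>p. c) U"
  by (induction k arbitrary: c) simp_all

lemma times_differentiable_on_add:
  "\<lbrakk>open U; times_differentiable_on k f U; times_differentiable_on k g U\<rbrakk>
    \<Longrightarrow> times_differentiable_on k (\<lambda>p. f p + g p) U"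
proof (induction k arbitrary: f g)
  case 0
  then show ?case by (simp add: continuous_on_add)
next
  case (Suc k)
  have "times_differentiable_on k (pd v (\<lambda>p. f p + g p)) U" for v
  proof (rule times_differentiable_on_cong[OF \<open>open U\<close>])
    show "pd v f p + pd v g p = pd v (\<lambda>p. f p + g p) p" if "p \<in> U" for p
      using Suc.prems that
      by (intro pd_eqI[symmetric, where f' = "\<lambda>v. pd v f p + pd v g p"] has_derivative_add
            has_frechet_derivative) auto
    show "times_differentiable_on k (\<lambda>p. pd v f p + pd v g p) U"
      using Suc by simp
  qed
  then show ?case using Suc.prems by simp
qed

lemma times_differentiable_on_bounded_linear:
  assumes "bounded_linear L" "open U"
  shows "times_differentiable_on k f U \<Longrightarrow> times_differentiable_on k (\<lambda>p. L (f p)) U"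
proof (induction k arbitrary: f)
  case 0
  then show ?case using assms by (simp add: bounded_linear.continuous_on)
next
  case (Suc k)
  have "times_differentiable_on k (pd v (\<lambda>p. L (f p))) U" for v
  proof (rule times_differentiable_on_cong[OF \<open>open U\<close>])
    show "L (pd v f p) = pd v (\<lambda>p. L (f p)) p" if "p \<in> U" for p
      using Suc.prems that by (simp add: pd_bounded_linear[OF assms(1)])
    show "times_differentiable_on k (\<lambda>p. L (pd v f p)) U"
      using Suc by simp
  qed
  moreover have "(\<lambda>p. L (f p)) differentiable (at p)" if "p \<in> U" for p
    by (rule differentiableI)
       (rule bounded_linear.has_derivative[OF assms(1) has_frechet_derivative], use Suc.prems that in simp)
  ultimately show ?case by simp
qed

text \<open>Multiplication of reals, scaling of a field by a function and the inner product are all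
  instances.\<close>

lemma times_differentiable_on_bounded_bilinear:
  assumes "bounded_bilinear B" "open U"
  shows "\<lbrakk>times_differentiable_on k f U; times_differentiable_on k g U\<rbrakk>
    \<Longrightarrow> times_differentiable_on k (\<lambda>p. B (f p) (g p)) U"
proof (induction k arbitrary: f g)
  case 0
  then show ?case using bounded_bilinear.continuous_on[OF assms(1)] by simp
next
  case (Suc k)
  have "times_differentiable_on k (pd v (\<lambda>p. B (f p) (g p))) U" for v
  proof (rule times_differentiable_on_cong[OF \<open>open U\<close>])
    show "B (f p) (pd v g p) + B (pd v f p) (g p) = pd v (\<lambda>p. B (f p) (g p)) p" if "p \<in> U" for p
      using Suc.prems that by (simp add: pd_bounded_bilinear[OF assms(1)])
    show "times_differentiable_on k (\<lambda>p. B (f p) (pd v g p) + B (pd v f p) (g p)) U"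
      using Suc.prems assms(2)
      by (intro times_differentiable_on_add Suc.IH times_differentiable_on_SucD[of k f]
            times_differentiable_on_SucD[of k g]) simp_all
  qed
  moreover have "(\<lambda>p. B (f p) (g p)) differentiable (at p)" if "p \<in> U" for p
    by (rule differentiableI)
       (rule bounded_bilinear.FDERIV[OF assms(1) has_frechet_derivative has_frechet_derivative],
         use Suc.prems that in simp_all)
  ultimately show ?case by simp
qed

lemma pd_inverse:
  fixes f :: "'a::real_normed_vector \<Rightarrow> real"
  assumes "f differentiable (at p)" "f p \<noteq> 0"
  shows "pd v (\<lambda>q. inverse (f q)) p = - (pd v f p * (inverse (f p) * inverse (f p)))"
    and "(\<lambda>q. inverse (f q)) differentiable (at p)"
proof -
  have *: "((\<lambda>q. inverse (f q)) has_derivative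
      (\<lambda>v. - (inverse (f p) * pd v f p * inverse (f p)))) (at p)"
    using Deriv.has_derivative_inverse[OF assms(2) has_frechet_derivative[OF assms(1)]] by simp
  show "pd v (\<lambda>q. inverse (f q)) p = - (pd v f p * (inverse (f p) * inverse (f p)))"
    using pd_eqI[OF *, of v] by (simp add: mult_ac)
  show "(\<lambda>q. inverse (f q)) differentiable (at p)"
    using * by (rule differentiableI)
qed

lemma times_differentiable_on_inverse:
  fixes f :: "'a::real_normed_vector \<Rightarrow> real"
  assumes "open U" and nz: "\<And>p. p \<in> U \<Longrightarrow> f p \<noteq> 0"
  shows "times_differentiable_on k f U \<Longrightarrow> times_differentiable_on k (\<lambda>p. inverse (f p)) U"
proof (induction k)
  case 0
  then show ?case using nz by (simp add: continuous_on_inverse)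
next
  case (Suc k)
  have "times_differentiable_on k (pd v (\<lambda>p. inverse (f p))) U" for v
  proof (rule times_differentiable_on_cong[OF \<open>open U\<close>])
    show "- (pd v f p * (inverse (f p) * inverse (f p))) = pd v (\<lambda>p. inverse (f p)) p" if "p \<in> U" for p
      using pd_inverse(1)[of f p v] nz[OF that] Suc.prems that by simp
    have "times_differentiable_on k (\<lambda>p. inverse (f p)) U"
      using Suc times_differentiable_on_SucD by blast
    then show "times_differentiable_on k (\<lambda>p. - (pd v f p * (inverse (f p) * inverse (f p)))) U"
      using Suc.prems assms(1)
      by (intro times_differentiable_on_bounded_linear[OF bounded_linear_minus[OF bounded_linear_ident]]
            times_differentiable_on_bounded_bilinear[OF bounded_bilinear_mult]) simp_all
  qed
  then show ?case using Suc.prems pd_inverse(2) nz by simp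
qed

lemma smooth_on_cong:
  "\<lbrakk>open U; smooth_on U f; \<And>p. p \<in> U \<Longrightarrow> f p = g p\<rbrakk> \<Longrightarrow> smooth_on U g"
  using times_differentiable_on_cong by (metis smooth_on_def)

lemma smooth_on_subset: "\<lbrakk>smooth_on U f; V \<subseteq> U\<rbrakk> \<Longrightarrow> smooth_on V f"
  by (simp add: smooth_on_def times_differentiable_on_subset)

lemma smooth_on_differentiable: "\<lbrakk>smooth_on U f; p \<in> U\<rbrakk> \<Longrightarrow> f differentiable (at p)"
  by (meson smooth_on_def times_differentiable_on.simps(2))

lemma smooth_on_pd: "smooth_on U f \<Longrightarrow> smooth_on U (pd v f)"
  unfolding smooth_on_def using times_differentiable_on.simps(2) by blast

lemma smooth_onI:
  assumes "\<And>p. p \<in> U \<Longrightarrow> f differentiable (at p)" "\<And>v. smooth_on U (pd v f)"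
  shows "smooth_on U f"
proof -
  have "times_differentiable_on k f U" for k
    using assms times_differentiable_on_SucD[of k f U] by (simp add: smooth_on_def)
  then show ?thesis by (simp add: smooth_on_def)
qed

lemma smooth_on_const: "smooth_on U (\<lambda>p. c)"
  by (simp add: smooth_on_def times_differentiable_on_const)

lemma smooth_on_ident: "smooth_on U (\<lambda>p. p)"
  by (rule smooth_onI) (simp_all add: smooth_on_const)

lemma smooth_on_add: "\<lbrakk>open U; smooth_on U f; smooth_on U g\<rbrakk> \<Longrightarrow> smooth_on U (\<lambda>p. f p + g p)"
  by (simp add: smooth_on_def times_differentiable_on_add)

lemma smooth_on_bounded_linear:
  "\<lbrakk>bounded_linear L; open U; smooth_on U f\<rbrakk> \<Longrightarrow> smooth_on U (\<lambda>p. L (f p))"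
  by (simp add: smooth_on_def times_differentiable_on_bounded_linear)

lemma smooth_on_bounded_bilinear:
  "\<lbrakk>bounded_bilinear B; open U; smooth_on U f; smooth_on U g\<rbrakk> \<Longrightarrow> smooth_on U (\<lambda>p. B (f p) (g p))"
  by (simp add: smooth_on_def times_differentiable_on_bounded_bilinear)

lemmas smooth_on_scaleR = smooth_on_bounded_bilinear[OF bounded_bilinear_scaleR]
lemmas smooth_on_inner = smooth_on_bounded_bilinear[OF bounded_bilinear_inner]
lemmas smooth_on_minus = smooth_on_bounded_linear[OF bounded_linear_minus[OF bounded_linear_ident]]
lemmas smooth_on_component = smooth_on_bounded_linear[OF bounded_linear_vec_nth]

lemma smooth_on_mult:
  fixes f g :: "'a::real_normed_vector \<Rightarrow> real"
  shows "\<lbrakk>open U; smooth_on U f; smooth_on U g\<rbrakk> \<Longrightarrow> smooth_on U (\<lambda>p. f p * g p)"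
  by (rule smooth_on_bounded_bilinear[OF bounded_bilinear_mult])

lemma smooth_on_diff: "\<lbrakk>open U; smooth_on U f; smooth_on U g\<rbrakk> \<Longrightarrow> smooth_on U (\<lambda>p. f p - g p)"
  using smooth_on_add[of U f "\<lambda>p. - g p"] smooth_on_minus[of U g] by simp

lemma smooth_on_divide:
  fixes f g :: "'a::real_normed_vector \<Rightarrow> real"
  assumes "open U" "smooth_on U f" "smooth_on U g" "\<And>p. p \<in> U \<Longrightarrow> g p \<noteq> 0"
  shows "smooth_on U (\<lambda>p. f p / g p)"
proof -
  have "smooth_on U (\<lambda>p. inverse (g p))"
    using assms by (simp add: smooth_on_def times_differentiable_on_inverse)
  then show ?thesis using assms smooth_on_mult by (simp add: divide_inverse)
qed

lemma smooth_on_sum: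
  "\<lbrakk>open U; \<And>i. i \<in> I \<Longrightarrow> smooth_on U (f i)\<rbrakk> \<Longrightarrow> smooth_on U (\<lambda>p. \<Sum>i\<in>I. f i p)"
  by (induction I rule: infinite_finite_induct) (simp_all add: smooth_on_const smooth_on_add)

lemma smooth_on_prod:
  fixes f :: "'i \<Rightarrow> 'a::real_normed_vector \<Rightarrow> real"
  shows "\<lbrakk>open U; \<And>i. i \<in> I \<Longrightarrow> smooth_on U (f i)\<rbrakk> \<Longrightarrow> smooth_on U (\<lambda>p. \<Prod>i\<in>I. f i p)"
  by (induction I rule: infinite_finite_induct) (simp_all add: smooth_on_const smooth_on_mult)

lemma smooth_on_vec:
  fixes f :: "'a::real_normed_vector \<Rightarrow> real^'n::finite"
  assumes "open U" "\<And>i. smooth_on U (\<lambda>p. f p $ i)"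
  shows "smooth_on U f"
proof -
  have "smooth_on U (\<lambda>p. \<Sum>i\<in>UNIV. f p $ i *\<^sub>R axis i (1::real))"
    using assms by (intro smooth_on_sum smooth_on_scaleR smooth_on_const)
  moreover have "(\<Sum>i\<in>UNIV. f p $ i *\<^sub>R axis i (1::real)) = f p" for p
    using basis_expansion[of "f p"] by (simp add: scalar_mult_eq_scaleR)
  ultimately show ?thesis by simp
qed

lemma smooth_on_det:
  fixes A :: "'a::real_normed_vector \<Rightarrow> real^'n::finite^'n"
  assumes "open U" "\<And>i j. smooth_on U (\<lambda>p. A p $ i $ j)"
  shows "smooth_on U (\<lambda>p. det (A p))"
  unfolding det_def using assms
  by (intro smooth_on_sum smooth_on_mult smooth_on_prod smooth_on_const)

text \<open>Cramer's rule writes the solution of a linear system as a quotient of polynomials in the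
  coefficients. Both the inverse of a metric and the coordinate fields of a chart are such
  solutions.\<close>

lemma smooth_on_linear_solution:
  fixes A :: "'a::real_normed_vector \<Rightarrow> real^'n::finite^'n"
  assumes U: "open U" and A: "\<And>i j. smooth_on U (\<lambda>p. A p $ i $ j)" and b: "smooth_on U b"
    and eq: "\<And>p. p \<in> U \<Longrightarrow> det (A p) \<noteq> 0 \<and> A p *v y p = b p"
  shows "smooth_on U y"
proof (rule smooth_on_vec[OF U])
  fix k
  let ?C = "\<lambda>p. (\<chi> i j. if j = k then b p $ i else A p $ i $ j) :: real^'n^'n"
  have "smooth_on U (\<lambda>p. det (?C p) / det (A p))"
  proof (intro smooth_on_divide smooth_on_det U A)
    show "smooth_on U (\<lambda>p. ?C p $ i $ j)" for i j
      using A smooth_on_component[OF U b] by (cases "j = k") simp_all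
  qed (use eq in auto)
  then show "smooth_on U (\<lambda>p. y p $ k)"
  proof (rule smooth_on_cong[OF U])
    fix p assume "p \<in> U"
    then have "y p = (\<chi> k. det (\<chi> i j. if j = k then b p $ i else A p $ i $ j) / det (A p))"
      using eq cramer by blast
    then show "det (?C p) / det (A p) = y p $ k" by simp
  qed
qed

lemma linear_expand_axis:
  fixes L :: "real^'n::finite \<Rightarrow> 'b::real_vector"
  assumes "linear L"
  shows "L v = (\<Sum>i\<in>UNIV. v $ i *\<^sub>R L (axis i 1))"
proof -
  have "L v = L (\<Sum>i\<in>UNIV. v $ i *\<^sub>R axis i 1)"
    using basis_expansion[of v] by (simp add: scalar_mult_eq_scaleR)
  also have "\<dots> = (\<Sum>i\<in>UNIV. v $ i *\<^sub>R L (axis i 1))"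
    by (simp add: linear_sum[OF assms] linear_cmul[OF assms])
  finally show ?thesis .
qed

lemma bilinear_expand_axis:
  assumes "bilinear B"
  shows "B u v = (\<Sum>i\<in>UNIV. \<Sum>j\<in>UNIV. (u $ i * v $ j) *\<^sub>R B (axis i 1 :: real^'k::finite) (axis j 1 :: real^'l::finite))"
  using linear_expand_axis[of "\<lambda>u. B u v" u] linear_expand_axis[of "B (axis _ 1)" v] assms
  by (simp add: bilinear_def scaleR_sum_right)

lemma pd_expand_axis:
  fixes f :: "real^'n::finite \<Rightarrow> 'b::real_normed_vector"
  assumes "f differentiable (at p)"
  shows "pd v f p = (\<Sum>i\<in>UNIV. v $ i *\<^sub>R pd (axis i 1) f p)"
  by (rule linear_expand_axis) (rule linear_frechet_derivative[OF assms])

lemma smooth_on_along: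
  assumes "open U" "smooth_on U X" "smooth_on U f"
  shows "smooth_on U (along X f)"
proof (rule smooth_on_cong[OF assms(1)])
  show "smooth_on U (\<lambda>p. \<Sum>i\<in>UNIV. X p $ i *\<^sub>R pd (axis i 1) f p)"
    using assms by (intro smooth_on_sum smooth_on_scaleR smooth_on_component smooth_on_pd)
  show "(\<Sum>i\<in>UNIV. X p $ i *\<^sub>R pd (axis i 1) f p) = along X f p" if "p \<in> U" for p
    using pd_expand_axis[of f p "X p"] smooth_on_differentiable[OF assms(3) that]
    by (simp add: along_def)
qed

lemma DERIV_along_line:
  fixes f :: "'a::real_normed_vector \<Rightarrow> real"
  assumes "f differentiable (at (a + x *\<^sub>R v))"
  shows "((\<lambda>x. f (a + x *\<^sub>R v)) has_field_derivative pd v f (a + x *\<^sub>R v)) (at x)"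
proof -
  have "((\<lambda>x. a + x *\<^sub>R v) has_derivative (\<lambda>h. h *\<^sub>R v)) (at x)"
    by (auto intro!: derivative_eq_intros)
  then have "((\<lambda>x. f (a + x *\<^sub>R v)) has_derivative (\<lambda>h. pd (h *\<^sub>R v) f (a + x *\<^sub>R v))) (at x)"
    using has_derivative_compose[of "\<lambda>x. a + x *\<^sub>R v"] has_frechet_derivative[OF assms] by blast
  moreover have "pd (h *\<^sub>R v) f (a + x *\<^sub>R v) = pd v f (a + x *\<^sub>R v) * h" for h
    using linear_cmul[OF linear_frechet_derivative[OF assms]] by simp
  ultimately show ?thesis by (simp add: has_field_derivative_def)
qed

text \<open>Applying the mean value theorem twice turns the second difference quotient over a
  parallelogram into a mixed second derivative at some point of it. The quotient does not
  distinguish its two sides, so both mixed derivatives share a limit.\<close>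

lemma second_difference_mean_value:
  fixes f :: "'a::real_normed_vector \<Rightarrow> real"
  assumes h: "h > 0"
    and inU: "\<And>s t. 0 \<le> s \<Longrightarrow> s \<le> h \<Longrightarrow> 0 \<le> t \<Longrightarrow> t \<le> h \<Longrightarrow> p + s *\<^sub>R u + t *\<^sub>R v \<in> U"
    and f: "\<And>q. q \<in> U \<Longrightarrow> f differentiable (at q)"
    and f': "\<And>q. q \<in> U \<Longrightarrow> pd v f differentiable (at q)"
  shows "\<exists>s t. 0 \<le> s \<and> s \<le> h \<and> 0 \<le> t \<and> t \<le> h \<and>
    f (p + h *\<^sub>R u + h *\<^sub>R v) - f (p + h *\<^sub>R u) - f (p + h *\<^sub>R v) + f p
      = h * h * pd u (pd v f) (p + s *\<^sub>R u + t *\<^sub>R v)"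
proof -
  define \<phi> where "\<phi> t = f (p + h *\<^sub>R u + t *\<^sub>R v) - f (p + t *\<^sub>R v)" for t
  define \<phi>' where "\<phi>' t = pd v f (p + h *\<^sub>R u + t *\<^sub>R v) - pd v f (p + t *\<^sub>R v)" for t
  have "DERIV \<phi> t :> \<phi>' t" if "0 \<le> t" "t \<le> h" for t
    unfolding \<phi>_def \<phi>'_def using inU[of h t] inU[of 0 t] h that
    by (intro DERIV_diff DERIV_along_line f) simp_all
  then obtain t where t: "0 < t" "t < h" "\<phi> h - \<phi> 0 = (h - 0) * \<phi>' t"
    using MVT2[OF h, of \<phi> \<phi>'] by blast
  have "DERIV (\<lambda>s. pd v f ((p + t *\<^sub>R v) + s *\<^sub>R u)) s :> pd u (pd v f) ((p + t *\<^sub>R v) + s *\<^sub>R u)"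
    if "0 \<le> s" "s \<le> h" for s
    using inU[of s t] that t by (intro DERIV_along_line f') (simp add: ac_simps)
  then obtain s where s: "0 < s" "s < h"
    "pd v f ((p + t *\<^sub>R v) + h *\<^sub>R u) - pd v f ((p + t *\<^sub>R v) + 0 *\<^sub>R u)
      = (h - 0) * pd u (pd v f) ((p + t *\<^sub>R v) + s *\<^sub>R u)"
    using MVT2[OF h, of "\<lambda>s. pd v f ((p + t *\<^sub>R v) + s *\<^sub>R u)"
        "\<lambda>s. pd u (pd v f) ((p + t *\<^sub>R v) + s *\<^sub>R u)"] by blast
  then have "\<phi>' t = h * pd u (pd v f) (p + s *\<^sub>R u + t *\<^sub>R v)"
    by (simp add: \<phi>'_def ac_simps)
  then have "\<phi> h - \<phi> 0 = h * h * pd u (pd v f) (p + s *\<^sub>R u + t *\<^sub>R v)"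
    using t(3) by simp
  then have "f (p + h *\<^sub>R u + h *\<^sub>R v) - f (p + h *\<^sub>R u) - f (p + h *\<^sub>R v) + f p
      = h * h * pd u (pd v f) (p + s *\<^sub>R u + t *\<^sub>R v)"
    by (simp add: \<phi>_def)
  then show ?thesis using s(1,2) t(1,2) by (meson less_imp_le)
qed

lemma pd_commute_real:
  fixes f :: "'a::real_normed_vector \<Rightarrow> real"
  assumes U: "open U" and f: "smooth_on U f" and p: "p \<in> U"
  shows "pd u (pd v f) p = pd v (pd u f) p"
proof (rule ccontr)
  let ?A = "pd u (pd v f)" and ?B = "pd v (pd u f)"
  assume "?A p \<noteq> ?B p"
  define \<epsilon> where "\<epsilon> = \<bar>?A p - ?B p\<bar> / 2"
  have \<epsilon>: "\<epsilon> > 0" using \<open>?A p \<noteq> ?B p\<close> by (simp add: \<epsilon>_def)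
  have "isCont ?A p" "isCont ?B p"
    using f p by (auto intro!: differentiable_imp_continuous_within smooth_on_differentiable smooth_on_pd)
  then obtain r1 r2 where r1: "r1 > 0" "\<And>q. dist q p < r1 \<Longrightarrow> dist (?A q) (?A p) < \<epsilon>"
    and r2: "r2 > 0" "\<And>q. dist q p < r2 \<Longrightarrow> dist (?B q) (?B p) < \<epsilon>"
    using \<epsilon> unfolding continuous_at_eps_delta by metis
  obtain r3 where r3: "r3 > 0" "ball p r3 \<subseteq> U" using U p open_contains_ball by blast
  define r where "r = min r1 (min r2 r3)"
  define N where "N = norm u + norm v + 1"
  define h where "h = r / (2 * N)"
  have n: "N > 0" by (simp add: N_def add_nonneg_pos)
  have r: "r > 0" using r1 r2 r3 by (simp add: r_def)
  have h: "h > 0" using r n by (simp add: h_def)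
  have close: "dist (p + s *\<^sub>R u + t *\<^sub>R v) p < r"
    if "0 \<le> s" "s \<le> h" "0 \<le> t" "t \<le> h" for s t
  proof -
    have "dist (p + s *\<^sub>R u + t *\<^sub>R v) p \<le> s * norm u + t * norm v"
      using norm_triangle_ineq[of "s *\<^sub>R u" "t *\<^sub>R v"] that by (simp add: dist_norm ac_simps)
    also have "\<dots> \<le> h * norm u + h * norm v"
      using that by (intro add_mono mult_right_mono) auto
    also have "\<dots> \<le> h * N" using h by (simp add: N_def algebra_simps)
    also have "\<dots> = r / 2" using n by (simp add: h_def)
    also have "\<dots> < r" using r by simp
    finally show ?thesis .
  qed
  have inU: "p + s *\<^sub>R u + t *\<^sub>R v \<in> U" if "0 \<le> s" "s \<le> h" "0 \<le> t" "t \<le> h" for s t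
    using close[OF that] r3(2) by (auto simp: r_def dist_commute)
  have inU': "p + s *\<^sub>R v + t *\<^sub>R u \<in> U" if "0 \<le> s" "s \<le> h" "0 \<le> t" "t \<le> h" for s t
    using inU[of t s] that by (simp add: ac_simps)
  have d: "g differentiable (at q)" if "smooth_on U g" "q \<in> U" for g :: "'a \<Rightarrow> real" and q
    using that by (rule smooth_on_differentiable)
  obtain s t where st: "0 \<le> s" "s \<le> h" "0 \<le> t" "t \<le> h"
    and A: "f (p + h *\<^sub>R u + h *\<^sub>R v) - f (p + h *\<^sub>R u) - f (p + h *\<^sub>R v) + f p
      = h * h * ?A (p + s *\<^sub>R u + t *\<^sub>R v)"
    using second_difference_mean_value[OF h, of p u v U f] inU d[OF f] d[OF smooth_on_pd[OF f]] by blast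
  obtain s' t' where st': "0 \<le> s'" "s' \<le> h" "0 \<le> t'" "t' \<le> h"
    and B: "f (p + h *\<^sub>R v + h *\<^sub>R u) - f (p + h *\<^sub>R v) - f (p + h *\<^sub>R u) + f p
      = h * h * ?B (p + s' *\<^sub>R v + t' *\<^sub>R u)"
    using second_difference_mean_value[OF h, of p v u U f] inU' d[OF f] d[OF smooth_on_pd[OF f]] by blast
  have "h * h * ?A (p + s *\<^sub>R u + t *\<^sub>R v) = h * h * ?B (p + s' *\<^sub>R v + t' *\<^sub>R u)"
    unfolding A[symmetric] B[symmetric] by (simp add: add.commute add.left_commute)
  then have "?A (p + s *\<^sub>R u + t *\<^sub>R v) = ?B (p + s' *\<^sub>R v + t' *\<^sub>R u)"
    using h by simp
  moreover have "dist (?A (p + s *\<^sub>R u + t *\<^sub>R v)) (?A p) < \<epsilon>"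
    using close[OF st] by (intro r1(2)) (simp add: r_def)
  moreover have "dist (?B (p + s' *\<^sub>R v + t' *\<^sub>R u)) (?B p) < \<epsilon>"
    using close[OF st'(3,4,1,2)] by (intro r2(2)) (simp add: r_def ac_simps)
  ultimately have "\<bar>?A p - ?B p\<bar> < 2 * \<epsilon>" by (simp add: dist_real_def)
  then show False by (simp add: \<epsilon>_def)
qed

lemma pd_commute:
  fixes f :: "'a::real_normed_vector \<Rightarrow> real^'n::finite"
  assumes U: "open U" and f: "smooth_on U f" and p: "p \<in> U"
  shows "pd u (pd v f) p = pd v (pd u f) p"
proof -
  have component: "pd u (pd v f) p $ i = pd u (pd v (\<lambda>q. f q $ i)) p" for u v i
  proof -
    have "pd u (pd v f) p $ i = pd u (\<lambda>q. pd v f q $ i) p"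
      using smooth_on_differentiable[OF smooth_on_pd[OF f] p]
      by (simp add: pd_bounded_linear[OF bounded_linear_vec_nth])
    also have "\<dots> = pd u (pd v (\<lambda>q. f q $ i)) p"
      using smooth_on_differentiable[OF f]
      by (subst frechet_derivative_cong_open[OF U p])
         (simp_all add: pd_bounded_linear[OF bounded_linear_vec_nth])
    finally show ?thesis .
  qed
  show ?thesis
    by (simp add: vec_eq_iff component pd_commute_real[OF U smooth_on_component[OF U f] p])
qed

text \<open>The Leibniz rule, applied after \<open>Y\<close> is expanded in the constant fields \<open>axis i 1\<close>, separates the
  derivatives of the coefficients of \<open>Y\<close> from the second derivatives of \<open>f\<close>. Only the latter are
  symmetric; the former make up the Lie bracket.\<close>

lemma along_along:
  assumes U: "open U" and Y: "smooth_on U Y" and f: "smooth_on U f" and p: "p \<in> U"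
  shows "along X (along Y f) p = pd (along X Y p) f p + pd (X p) (pd (Y p) f) p"
proof -
  have diff: "f differentiable (at q)" if "q \<in> U" for q
    using f that by (rule smooth_on_differentiable)
  have "((\<lambda>q. \<Sum>i\<in>UNIV. Y q $ i *\<^sub>R pd (axis i 1) f q) has_derivative
      (\<lambda>v. \<Sum>i\<in>UNIV. Y p $ i *\<^sub>R pd v (pd (axis i 1) f) p + pd v Y p $ i *\<^sub>R pd (axis i 1) f p)) (at p)"
    using p Y f
    by (intro has_derivative_sum has_derivative_scaleR
          bounded_linear.has_derivative[OF bounded_linear_vec_nth]
          has_frechet_derivative smooth_on_differentiable[of U] smooth_on_pd)
  note D = pd_eqI[OF this]
  have "((\<lambda>q. \<Sum>i\<in>UNIV. Y p $ i *\<^sub>R pd (axis i 1) f q) has_derivative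
      (\<lambda>v. \<Sum>i\<in>UNIV. Y p $ i *\<^sub>R pd v (pd (axis i 1) f) p)) (at p)"
    using p f
    by (intro has_derivative_sum has_derivative_scaleR_right has_frechet_derivative
          smooth_on_differentiable[of U] smooth_on_pd)
  note D' = pd_eqI[OF this]
  have "along X (along Y f) p = along X (\<lambda>q. \<Sum>i\<in>UNIV. Y q $ i *\<^sub>R pd (axis i 1) f q) p"
    using diff pd_expand_axis[of f _ "Y _"]
    by (intro along_cong_open[OF U p]) (simp add: along_def)
  also have "\<dots> = (\<Sum>i\<in>UNIV. Y p $ i *\<^sub>R pd (X p) (pd (axis i 1) f) p)
      + (\<Sum>i\<in>UNIV. along X Y p $ i *\<^sub>R pd (axis i 1) f p)"
    by (simp add: along_def D sum.distrib)
  also have "(\<Sum>i\<in>UNIV. Y p $ i *\<^sub>R pd (X p) (pd (axis i 1) f) p) = pd (X p) (pd (Y p) f) p"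
    using pd_expand_axis[OF diff, of _ "Y p"]
    by (subst frechet_derivative_cong_open[OF U p, where g = "\<lambda>q. \<Sum>i\<in>UNIV. Y p $ i *\<^sub>R pd (axis i 1) f q"])
       (simp_all add: D')
  also have "(\<Sum>i\<in>UNIV. along X Y p $ i *\<^sub>R pd (axis i 1) f p) = pd (along X Y p) f p"
    using pd_expand_axis[OF diff[OF p], of "along X Y p"] by simp
  finally show ?thesis by simp
qed

text \<open>Second derivatives commute, so the standard connection \<open>along\<close> of the chart is flat.\<close>

lemma along_commutator:
  fixes f :: "real^'n::finite \<Rightarrow> real^'m::finite"
  assumes U: "open U" and "smooth_on U X" "smooth_on U Y" "smooth_on U f" and p: "p \<in> U"
  shows "along X (along Y f) p - along Y (along X f) p = along (lie_bracket X Y) f p"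
proof -
  have "along (lie_bracket X Y) f p = pd (along X Y p) f p - pd (along Y X p) f p"
    using linear_diff[OF linear_frechet_derivative[OF smooth_on_differentiable[OF assms(4) p]]]
    by (simp add: along_def lie_bracket_def)
  then show ?thesis
    using assms by (simp add: along_along pd_commute[OF U assms(4) p, of "X p"])
qed

section \<open>Hessian structures\<close>

lemma constant_on_ball:
  fixes f :: "'a::real_normed_vector \<Rightarrow> 'b::real_normed_vector"
  assumes "smooth_on (ball p r) f" "\<And>q v. q \<in> ball p r \<Longrightarrow> pd v f q = 0"
  shows "\<exists>c. \<forall>q\<in>ball p r. f q = c"
proof -
  have "(f has_derivative (\<lambda>h. 0)) (at q within ball p r)" if "q \<in> ball p r" for q
  proof -
    have "frechet_derivative f (at q) = (\<lambda>h. 0)" using assms(2)[OF that] by auto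
    then show ?thesis
      using has_frechet_derivative[OF smooth_on_differentiable[OF assms(1) that]]
      by (auto intro: has_derivative_at_withinI)
  qed
  then show ?thesis
    using has_derivative_zero_constant[of "ball p r" f] by (auto simp: convex_ball)
qed

lemma det_nz_iff_inj_mult:
  fixes A :: "real^'n::finite^'n"
  shows "det A \<noteq> 0 \<longleftrightarrow> inj ((*v) A)"
  using det_nz_iff_inj[OF matrix_vector_mul_linear[of A]] by simp

lemma matrix_inv_right:
  fixes A :: "real^'n::finite^'n"
  assumes "det A \<noteq> 0"
  shows "A ** matrix_inv A = mat 1"
proof -
  have "\<exists>A'. A ** A' = mat 1 \<and> A' ** A = mat 1"
    using assms by (simp add: invertible_det_nz[symmetric] invertible_def)
  then show ?thesis unfolding matrix_inv_def by (rule someI2_ex) blast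
qed

lemma coord_field_frechet_derivative:
  assumes "bij (frechet_derivative x (at p))"
  shows "frechet_derivative x (at p) (coord_field x a p) = axis a 1"
  using assms by (simp add: coord_field_def bij_is_surj surj_f_inv_f)

lemma smooth_on_coord_field:
  assumes U: "open U" and x: "smooth_on U x" and bij: "\<And>p. p \<in> U \<Longrightarrow> bij (frechet_derivative x (at p))"
  shows "smooth_on U (coord_field x a)"
proof (rule smooth_on_linear_solution[OF U])
  let ?A = "\<lambda>p. matrix (frechet_derivative x (at p))"
  show "smooth_on U (\<lambda>p. ?A p $ i $ j)" for i j
    using smooth_on_component[OF U smooth_on_pd[OF x]] by (simp add: matrix_def)
  show "smooth_on U (\<lambda>p. axis a 1)" by (rule smooth_on_const)
  fix p assume p: "p \<in> U"
  have lin: "linear (frechet_derivative x (at p))"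
    using smooth_on_differentiable[OF x p] by (rule linear_frechet_derivative)
  then have A: "?A p *v v = frechet_derivative x (at p) v" for v
    by (simp add: matrix_works)
  have "det (?A p) \<noteq> 0"
    using bij_is_inj[OF bij[OF p]] by (simp add: det_nz_iff_inj[OF lin])
  then show "det (?A p) \<noteq> 0 \<and> ?A p *v coord_field x a p = axis a 1"
    by (simp add: A coord_field_frechet_derivative[OF bij[OF p]])
qed

text \<open>A metric that is the second derivative of a function in the chart, with the third derivative of
  that function as 3-tensor. Everything the theorem asserts about \<open>\<alpha> = 1\<close> and \<open>\<alpha> = -1\<close>, and the
  curvature argument that excludes other values, already holds at this level.\<close>

locale hessian_structure =
  fixes \<Theta> :: "(real^'n::finite) set" and \<psi> :: "real^'n \<Rightarrow> real"
    and g :: "'n metric" and t :: "'n tensor3" and m :: "'n product"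
  assumes open_domain: "open \<Theta>"
    and smooth_potential: "smooth_on \<Theta> \<psi>"
    and metric_eq: "p \<in> \<Theta> \<Longrightarrow> g p u v = pd u (pd v \<psi>) p"
    and tensor_eq: "p \<in> \<Theta> \<Longrightarrow> t p u v w = pd u (pd v (pd w \<psi>)) p"
    and metric_pos: "p \<in> \<Theta> \<Longrightarrow> u \<noteq> 0 \<Longrightarrow> g p u u > 0"
    and product_eq: "m p u v = matrix_inv (gram g p) *v (\<chi> k. t p u v (axis k 1))"
begin

lemma smooth_pd_potential [intro]:
  "smooth_on \<Theta> (pd v \<psi>)" "smooth_on \<Theta> (pd u (pd v \<psi>))" "smooth_on \<Theta> (pd u (pd v (pd w \<psi>)))"
  by (intro smooth_on_pd smooth_potential)+

lemma smooth_metric: "smooth_on \<Theta> (\<lambda>p. g p u v)"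
  using smooth_on_cong[OF open_domain smooth_pd_potential(2), where g = "\<lambda>p. g p u v"] by (simp add: metric_eq)

lemma smooth_tensor: "smooth_on \<Theta> (\<lambda>p. t p u v w)"
  using smooth_on_cong[OF open_domain smooth_pd_potential(3), where g = "\<lambda>p. t p u v w"] by (simp add: tensor_eq)

lemma pd_metric: "p \<in> \<Theta> \<Longrightarrow> pd u (\<lambda>q. g q v w) p = t p u v w"
  by (simp add: tensor_eq frechet_derivative_cong_open[OF open_domain _ metric_eq])

lemma metric_commute: "p \<in> \<Theta> \<Longrightarrow> g p u v = g p v u"
  by (simp add: metric_eq pd_commute_real[OF open_domain smooth_potential])

lemma tensor_commute:
  assumes "p \<in> \<Theta>"
  shows "t p u v w = t p v u w" "t p u v w = t p u w v"
proof -
  show "t p u v w = t p v u w"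
    using assms by (simp add: tensor_eq pd_commute_real[OF open_domain smooth_pd_potential(1)])
  show "t p u v w = t p u w v"
    using frechet_derivative_cong_open[OF open_domain assms
        pd_commute_real[OF open_domain smooth_potential, of _ v w]] assms
    by (simp add: tensor_eq)
qed

lemma linear_metric_left: "p \<in> \<Theta> \<Longrightarrow> linear (\<lambda>u. g p u v)"
  by (simp add: metric_eq linear_frechet_derivative smooth_on_differentiable[OF smooth_pd_potential(1)])

lemma bilinear_metric: "p \<in> \<Theta> \<Longrightarrow> bilinear (g p)"
  using linear_metric_left metric_commute by (simp add: bilinear_def)

lemma linear_tensor: "p \<in> \<Theta> \<Longrightarrow> linear (\<lambda>u. t p u v w)"
  by (simp add: tensor_eq linear_frechet_derivative smooth_on_differentiable[OF smooth_pd_potential(2)])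

lemma gram_component: "p \<in> \<Theta> \<Longrightarrow> (gram g p *v u) $ i = g p (axis i 1) u"
  using linear_expand_axis[OF linear_metric_left[of p "axis i 1"], of u] metric_commute[of p]
  by (simp add: gram_def matrix_vector_mult_def mult.commute)

lemma inner_gram:
  assumes "p \<in> \<Theta>"
  shows "u \<bullet> (gram g p *v v) = g p u v"
  using linear_expand_axis[OF linear_metric_left[OF assms, of v], of u]
  by (simp add: inner_vec_def gram_component[OF assms])

lemma gram_nondegenerate:
  assumes "p \<in> \<Theta>"
  shows "det (gram g p) \<noteq> 0"
proof -
  have "u = 0" if "gram g p *v u = 0" for u
    using metric_pos[OF assms, of u] inner_gram[OF assms, of u u] that by auto
  then have "inj ((*v) (gram g p))"
    by (simp add: matrix_left_invertible_ker matrix_left_invertible_injective[symmetric] inj_matrix_vector_mult)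
  then show ?thesis by (simp add: det_nz_iff_inj_mult)
qed

lemma gram_eq_iff: "p \<in> \<Theta> \<Longrightarrow> gram g p *v u = gram g p *v v \<longleftrightarrow> u = v"
  using gram_nondegenerate by (simp add: det_nz_iff_inj_mult inj_eq)

lemma gram_product: "p \<in> \<Theta> \<Longrightarrow> gram g p *v m p u v = (\<chi> k. t p u v (axis k 1))"
  using gram_nondegenerate by (simp add: product_eq matrix_vector_mul_assoc matrix_inv_right)

lemma metric_product:
  assumes "p \<in> \<Theta>"
  shows "g p (m p u v) w = t p u v w"
proof -
  have "g p (m p u v) w = w \<bullet> (gram g p *v m p u v)"
    using assms by (simp add: inner_gram metric_commute)
  also have "\<dots> = (\<Sum>i\<in>UNIV. w $ i *\<^sub>R t p (axis i 1) u v)"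
    using tensor_commute[OF assms, of u v] tensor_commute[OF assms, of _ u v] assms by (simp add: gram_product inner_vec_def)
  also have "\<dots> = t p w u v" by (simp add: linear_expand_axis[OF linear_tensor[OF assms], of w])
  also have "\<dots> = t p u v w" using tensor_commute[OF assms] by metis
  finally show ?thesis .
qed

lemma metric_eqD:
  assumes "p \<in> \<Theta>" "\<And>w. g p u w = g p v w"
  shows "u = v"
proof (rule ccontr)
  assume "u \<noteq> v"
  then have "g p (u - v) (u - v) > 0" using metric_pos[OF assms(1)] by simp
  then show False
    using assms(2) linear_diff[OF linear_metric_left[OF assms(1)]] by simp
qed

lemma product_commute:
  assumes "p \<in> \<Theta>"
  shows "m p u v = m p v u"
  using tensor_commute(1)[OF assms, of u v] by (intro metric_eqD[OF assms]) (simp add: metric_product[OF assms])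

lemma bilinear_product:
  assumes "p \<in> \<Theta>"
  shows "bilinear (m p)"
proof -
  have "linear (\<lambda>u. m p u v)" for v
    using linear_add[OF linear_tensor[OF assms]] linear_cmul[OF linear_tensor[OF assms]]
      linear_add[OF linear_metric_left[OF assms]] linear_cmul[OF linear_metric_left[OF assms]]
    by (intro linearI metric_eqD[OF assms]) (simp_all add: metric_product[OF assms])
  then show ?thesis using product_commute[OF assms] by (simp add: bilinear_def)
qed

lemma smooth_product: "smooth_on \<Theta> (\<lambda>p. m p u v)"
proof (rule smooth_on_linear_solution[OF open_domain])
  show "smooth_on \<Theta> (\<lambda>p. gram g p $ i $ j)" for i j
    using smooth_metric by (simp add: gram_def)
  show "smooth_on \<Theta> (\<lambda>p. \<chi> k. t p u v (axis k 1))"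
    using smooth_tensor by (intro smooth_on_vec open_domain) simp
qed (simp add: gram_nondegenerate gram_product)

lemma smooth_product_fields:
  assumes "open U" "U \<subseteq> \<Theta>" "smooth_on U Y" "smooth_on U Z"
  shows "smooth_on U (\<lambda>p. m p (Y p) (Z p))"
proof (rule smooth_on_cong[OF assms(1)])
  show "smooth_on U (\<lambda>p. \<Sum>i\<in>UNIV. \<Sum>j\<in>UNIV. (Y p $ i * Z p $ j) *\<^sub>R m p (axis i 1) (axis j 1))"
    using assms smooth_on_subset[OF smooth_product assms(2)]
    by (intro smooth_on_sum smooth_on_scaleR smooth_on_mult smooth_on_component)
  show "(\<Sum>i\<in>UNIV. \<Sum>j\<in>UNIV. (Y p $ i * Z p $ j) *\<^sub>R m p (axis i 1) (axis j 1)) = m p (Y p) (Z p)"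
    if "p \<in> U" for p
    using that assms(2) by (subst (2) bilinear_expand_axis) (auto intro: bilinear_product)
qed

section \<open>The family of structure connections and their curvature\<close>

definition alpha_connection :: "real \<Rightarrow> 'n connection" where
  "alpha_connection \<alpha> Y Z p = levi_civita g Y Z p + (\<alpha> / 2) *\<^sub>R m p (Y p) (Z p)"

text \<open>All three derivatives of the metric in the Koszul formula are the same value of the symmetric
  tensor \<open>t\<close>, and two of them cancel.\<close>

lemma christoffel_eq:
  assumes "p \<in> \<Theta>"
  shows "christoffel g p u v = (1/2) *\<^sub>R m p u v"
proof -
  have "t p u v w + t p v u w - t p w u v = t p u v w" for w
    using tensor_commute[OF assms] by (smt (verit))
  then have "christoffel g p u v = matrix_inv (gram g p) *v ((1/2) *\<^sub>R (\<chi> k. t p u v (axis k 1)))"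
    by (simp add: christoffel_def pd_metric[OF assms] scaleR_vec_def)
  then show ?thesis by (simp add: product_eq matrix_vector_mult_scaleR)
qed

lemma alpha_connection_eq:
  assumes "p \<in> \<Theta>"
  shows "alpha_connection \<alpha> Y Z p = along Y Z p + ((1 + \<alpha>) / 2) *\<^sub>R m p (Y p) (Z p)"
  by (simp add: alpha_connection_def levi_civita_def christoffel_eq[OF assms] add_divide_distrib scaleR_left_distrib)

lemma smooth_alpha_connection:
  assumes "open U" "U \<subseteq> \<Theta>" "smooth_on U Y" "smooth_on U Z"
  shows "smooth_on U (alpha_connection \<alpha> Y Z)"
proof (rule smooth_on_cong[OF assms(1)])
  show "smooth_on U (\<lambda>p. along Y Z p + ((1 + \<alpha>) / 2) *\<^sub>R m p (Y p) (Z p))"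
    using assms by (intro smooth_on_add smooth_on_along smooth_on_scaleR smooth_on_const smooth_product_fields)
qed (use assms(2) in \<open>auto simp: alpha_connection_eq\<close>)

lemma affine_alpha_connection: "affine_connection_on \<Theta> (alpha_connection \<alpha>)"
  unfolding affine_connection_on_def
proof (intro allI impI conjI ballI)
  fix U and X X' Y Y' :: "'n field" and f :: "real^'n \<Rightarrow> real" and p
  assume U: "open U" "U \<subseteq> \<Theta>" and s: "smooth_on U X" "smooth_on U X'" "smooth_on U Y" "smooth_on U Y'" "smooth_on U f"
  show "smooth_on U (alpha_connection \<alpha> X Y)"
    by (rule smooth_alpha_connection[OF U s(1,3)])
  assume p: "p \<in> U"
  then have p': "p \<in> \<Theta>" using U by blast
  have diff: "Y differentiable at p" "Y' differentiable at p" "f differentiable at p"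
    using s p smooth_on_differentiable by blast+
  note lin = linear_frechet_derivative[OF diff(1)]
  note b = bilinear_product[OF p']
  note eq = alpha_connection_eq[OF p'] along_def
  show "alpha_connection \<alpha> (\<lambda>q. X q + X' q) Y p = alpha_connection \<alpha> X Y p + alpha_connection \<alpha> X' Y p"
    by (simp add: eq bilinear_ladd[OF b] linear_add[OF lin] algebra_simps)
  show "alpha_connection \<alpha> (\<lambda>q. f q *\<^sub>R X q) Y p = f p *\<^sub>R alpha_connection \<alpha> X Y p"
    by (simp add: eq bilinear_lmul[OF b] linear_cmul[OF lin] algebra_simps)
  have "pd v (\<lambda>q. Y q + Y' q) p = pd v Y p + pd v Y' p" for v
    by (rule pd_eqI) (intro has_derivative_add has_frechet_derivative diff)
  then show "alpha_connection \<alpha> X (\<lambda>q. Y q + Y' q) p = alpha_connection \<alpha> X Y p + alpha_connection \<alpha> X Y' p"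
    by (simp add: eq bilinear_radd[OF b] algebra_simps)
  show "alpha_connection \<alpha> X (\<lambda>q. f q *\<^sub>R Y q) p = along X f p *\<^sub>R Y p + f p *\<^sub>R alpha_connection \<alpha> X Y p"
    by (simp add: eq bilinear_rmul[OF b] pd_bounded_bilinear[OF bounded_bilinear_scaleR diff(3,1)] algebra_simps)
qed

lemma torsion_free_alpha_connection: "torsion_free_on \<Theta> (alpha_connection \<alpha>)"
  by (simp add: torsion_free_on_def torsion_def lie_bracket_def alpha_connection_eq product_commute)

lemma gram_expand: "(gram g p *v v) $ i = (\<Sum>j\<in>UNIV. v $ j * g p (axis i 1) (axis j 1))"
  by (simp add: gram_def matrix_vector_mult_def mult.commute)

lemma smooth_gram:
  assumes "open U" "U \<subseteq> \<Theta>" "smooth_on U Z"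
  shows "smooth_on U (\<lambda>p. gram g p *v Z p)"
proof (rule smooth_on_vec[OF assms(1)])
  fix i
  have "smooth_on U (\<lambda>p. \<Sum>j\<in>UNIV. Z p $ j * g p (axis i 1) (axis j 1))"
    using assms smooth_on_subset[OF smooth_metric assms(2)]
    by (intro smooth_on_sum smooth_on_mult smooth_on_component)
  then show "smooth_on U (\<lambda>p. (gram g p *v Z p) $ i)"
    by (simp add: gram_expand)
qed

text \<open>The derivative of the Gram matrix is the tensor \<open>t\<close>, which is the Gram matrix applied to the
  product.\<close>

lemma pd_gram:
  assumes U: "open U" "U \<subseteq> \<Theta>" and Z: "smooth_on U Z" and p: "p \<in> U"
  shows "pd u (\<lambda>q. gram g q *v Z q) p = gram g p *v (pd u Z p + m p u (Z p))"
proof (rule vec_eq_iff[THEN iffD2], rule allI)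
  fix i
  have p': "p \<in> \<Theta>" using U p by blast
  have "pd u (\<lambda>q. gram g q *v Z q) p $ i = pd u (\<lambda>q. (gram g q *v Z q) $ i) p"
    using smooth_on_differentiable[OF smooth_gram[OF U Z] p]
    by (simp add: pd_bounded_linear[OF bounded_linear_vec_nth])
  also have "\<dots> = pd u (\<lambda>q. \<Sum>j\<in>UNIV. Z q $ j * g q (axis i 1) (axis j 1)) p"
    by (simp add: gram_expand)
  also have "\<dots> = (\<Sum>j\<in>UNIV. Z p $ j * t p u (axis i 1) (axis j 1) + pd u Z p $ j * g p (axis i 1) (axis j 1))"
  proof (rule pd_eqI[THEN trans])
    show "((\<lambda>q. \<Sum>j\<in>UNIV. Z q $ j * g q (axis i 1) (axis j 1)) has_derivative
      (\<lambda>u. \<Sum>j\<in>UNIV. Z p $ j * pd u (\<lambda>q. g q (axis i 1) (axis j 1)) p + pd u Z p $ j * g p (axis i 1) (axis j 1))) (at p)"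
      by (intro has_derivative_sum has_derivative_mult bounded_linear.has_derivative[OF bounded_linear_vec_nth]
            has_frechet_derivative smooth_on_differentiable[OF Z p] smooth_on_differentiable[OF smooth_metric p'])
  qed (simp add: pd_metric[OF p'])
  also have "\<dots> = t p (Z p) u (axis i 1) + (gram g p *v pd u Z p) $ i"
    using linear_expand_axis[OF linear_tensor[OF p', of u "axis i 1"], of "Z p"] tensor_commute[OF p']
    by (simp add: sum.distrib gram_expand)
  also have "\<dots> = (gram g p *v (pd u Z p + m p u (Z p))) $ i"
    using tensor_commute(1)[OF p', of u "Z p"] by (simp add: matrix_vector_right_distrib gram_product[OF p'])
  finally show "pd u (\<lambda>q. gram g q *v Z q) p $ i = (gram g p *v (pd u Z p + m p u (Z p))) $ i" .
qed

text \<open>Lowering indices carries the connection for \<open>\<alpha> = 1\<close> to the flat connection of the chart. Its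
  flatness, its affine charts and its potential all come from this identity.\<close>

lemma along_gram:
  assumes "open U" "U \<subseteq> \<Theta>" "smooth_on U Z" "p \<in> U"
  shows "along X (\<lambda>q. gram g q *v Z q) p = gram g p *v alpha_connection 1 X Z p"
  using pd_gram[OF assms] assms by (simp add: along_def alpha_connection_eq subsetD)

lemma flat_alpha_connection_1:
  assumes s: "smooth_on \<Theta> X" "smooth_on \<Theta> Y" "smooth_on \<Theta> Z" and p: "p \<in> \<Theta>"
  shows "curvature (alpha_connection 1) X Y Z p = 0"
proof -
  let ?W = "\<lambda>q. gram g q *v Z q" and ?nab = "alpha_connection 1"
  note U = open_domain order_refl[of \<Theta>]
  have W: "smooth_on \<Theta> ?W" using smooth_gram[OF U s(3)] .
  have twice: "along A (along B ?W) p = gram g p *v ?nab A (?nab B Z) p"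
    if "smooth_on \<Theta> A" "smooth_on \<Theta> B" for A B
  proof -
    have "along A (along B ?W) p = along A (\<lambda>q. gram g q *v ?nab B Z q) p"
      by (rule along_cong_open[OF open_domain p along_gram[OF U s(3)]])
    also have "\<dots> = gram g p *v ?nab A (?nab B Z) p"
      by (rule along_gram[OF U smooth_alpha_connection[OF U that(2) s(3)] p])
    finally show ?thesis .
  qed
  have "gram g p *v curvature ?nab X Y Z p =
      along X (along Y ?W) p - along Y (along X ?W) p - along (lie_bracket X Y) ?W p"
    using s by (simp add: curvature_def matrix_vector_mult_diff_distrib twice along_gram[OF U s(3) p])
  also have "\<dots> = gram g p *v 0"
    using along_commutator[OF open_domain s(1,2) W p] by simp
  finally show ?thesis by (simp only: gram_eq_iff[OF p])
qed

lemma alpha_connection_twice: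
  fixes \<alpha> :: real
  assumes s: "smooth_on \<Theta> X" "smooth_on \<Theta> Y" "smooth_on \<Theta> Z" and p: "p \<in> \<Theta>"
  defines "s \<equiv> (1 + \<alpha>) / 2"
  shows "alpha_connection \<alpha> X (alpha_connection \<alpha> Y Z) p = along X (along Y Z) p
    + s *\<^sub>R (along X (\<lambda>q. m q (Y q) (Z q)) p + m p (X p) (along Y Z p))
    + s\<^sup>2 *\<^sub>R m p (X p) (m p (Y p) (Z p))"
proof -
  note U = open_domain order_refl[of \<Theta>]
  have "along X (alpha_connection \<alpha> Y Z) p = along X (\<lambda>q. along Y Z q + s *\<^sub>R m q (Y q) (Z q)) p"
    unfolding s_def by (rule along_cong_open[OF open_domain p alpha_connection_eq])
  also have "\<dots> = along X (along Y Z) p + s *\<^sub>R along X (\<lambda>q. m q (Y q) (Z q)) p"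
    unfolding along_def[of X]
    by (rule pd_eqI[OF has_derivative_add[OF has_frechet_derivative
            has_derivative_scaleR_right[OF has_frechet_derivative]]])
       (use s p in \<open>auto intro!: smooth_on_differentiable[of \<Theta>] smooth_on_along smooth_product_fields U\<close>)
  finally have "alpha_connection \<alpha> X (alpha_connection \<alpha> Y Z) p = along X (along Y Z) p
      + s *\<^sub>R along X (\<lambda>q. m q (Y q) (Z q)) p
      + s *\<^sub>R m p (X p) (along Y Z p + s *\<^sub>R m p (Y p) (Z p))"
    by (simp add: alpha_connection_eq[OF p] s_def)
  then show ?thesis
    by (simp add: bilinear_radd[OF bilinear_product[OF p]] bilinear_rmul[OF bilinear_product[OF p]]
        algebra_simps power2_eq_square)
qed

text \<open>With $s = \frac{1+\alpha}{2}$ the curvature is $s B + s^2 C$, where only \<open>C\<close>, the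
  commutator of multiplications, is algebraic. Flatness at $s = 1$ gives $B = -C$ and spares the
  computation of \<open>B\<close>; what remains is $(s^2 - s)\,C$.\<close>

lemma curvature_alpha_connection:
  assumes s: "smooth_on \<Theta> X" "smooth_on \<Theta> Y" "smooth_on \<Theta> Z" and p: "p \<in> \<Theta>"
  shows "curvature (alpha_connection \<alpha>) X Y Z p =
    ((\<alpha>\<^sup>2 - 1) / 4) *\<^sub>R (m p (X p) (m p (Y p) (Z p)) - m p (Y p) (m p (X p) (Z p)))"
proof -
  define B where "B = along X (\<lambda>q. m q (Y q) (Z q)) p + m p (X p) (along Y Z p)
    - (along Y (\<lambda>q. m q (X q) (Z q)) p + m p (Y p) (along X Z p)) - m p (lie_bracket X Y p) (Z p)"
  define C where "C = m p (X p) (m p (Y p) (Z p)) - m p (Y p) (m p (X p) (Z p))"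
  have poly: "curvature (alpha_connection \<alpha>) X Y Z p = ((1 + \<alpha>) / 2) *\<^sub>R B + ((1 + \<alpha>) / 2)\<^sup>2 *\<^sub>R C" for \<alpha>
  proof -
    have "curvature (alpha_connection \<alpha>) X Y Z p
        = (along X (along Y Z) p - along Y (along X Z) p - along (lie_bracket X Y) Z p)
          + ((1 + \<alpha>) / 2) *\<^sub>R B + ((1 + \<alpha>) / 2)\<^sup>2 *\<^sub>R C"
      unfolding curvature_def alpha_connection_twice[OF s p] alpha_connection_twice[OF s(2,1,3) p]
        alpha_connection_eq[OF p, of \<alpha> "lie_bracket X Y" Z] B_def C_def
      by (simp only: scaleR_right_diff_distrib scaleR_right_distrib diff_diff_eq add_diff_eq diff_add_eq
          diff_diff_eq2 add_ac)
    then show ?thesis using along_commutator[OF open_domain s p] by simp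
  qed
  have "B = - C"
    using poly[of 1] flat_alpha_connection_1[OF s p] by (simp add: add_eq_0_iff2)
  then have "curvature (alpha_connection \<alpha>) X Y Z p = (((1 + \<alpha>) / 2)\<^sup>2 - (1 + \<alpha>) / 2) *\<^sub>R C"
    by (simp add: poly scaleR_left_diff_distrib)
  also have "((1 + \<alpha>) / 2)\<^sup>2 - (1 + \<alpha>) / 2 = (\<alpha>\<^sup>2 - 1) / 4"
    by (simp add: power2_eq_square field_simps)
  finally show ?thesis by (simp add: C_def)
qed

lemma flat_alpha_connection:
  assumes "\<alpha>\<^sup>2 = 1"
  shows "flat_on \<Theta> (alpha_connection \<alpha>)"
  using assms by (simp add: flat_on_def curvature_alpha_connection)

lemma levi_civita_eq: "levi_civita g = alpha_connection 0"
  by (intro ext) (simp add: alpha_connection_def)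

lemma flat_levi_civita:
  assumes "flat_on \<Theta> (alpha_connection \<alpha>)" "\<alpha>\<^sup>2 \<noteq> 1"
  shows "flat_on \<Theta> (levi_civita g)"
  using assms by (simp add: flat_on_def levi_civita_eq curvature_alpha_connection)

lemma compatible_alpha_connection: "compatible_metric_on \<Theta> (alpha_connection \<alpha>) g"
proof -
  \<comment> \<open>The covariant derivative of \<open>g\<close> is a multiple of \<open>t\<close>, hence totally symmetric.\<close>
  have nab_g: "metric_derivative (alpha_connection \<alpha>) g X Y Z p = - (\<alpha> * t p (X p) (Y p) (Z p))"
    if s: "smooth_on \<Theta> X" "smooth_on \<Theta> Y" "smooth_on \<Theta> Z" and p: "p \<in> \<Theta>" for X Y Z p
  proof -
    note U = open_domain order_refl[of \<Theta>]
    note l = bilinear_ladd[OF bilinear_metric[OF p]] bilinear_lmul[OF bilinear_metric[OF p]]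
      bilinear_radd[OF bilinear_metric[OF p]] bilinear_rmul[OF bilinear_metric[OF p]]
    have "along X (\<lambda>q. g q (Y q) (Z q)) p = along X (\<lambda>q. Y q \<bullet> (gram g q *v Z q)) p"
      by (rule along_cong_open[OF open_domain p]) (simp add: inner_gram)
    also have "\<dots> = g p (Y p) (along X Z p + m p (X p) (Z p)) + g p (along X Y p) (Z p)"
      unfolding along_def
      by (subst pd_bounded_bilinear[OF bounded_bilinear_inner smooth_on_differentiable[OF s(2) p]
            smooth_on_differentiable[OF smooth_gram[OF U s(3)] p]])
         (simp add: pd_gram[OF U s(3) p] inner_gram[OF p])
    finally have *: "along X (\<lambda>q. g q (Y q) (Z q)) p
        = g p (Y p) (along X Z p) + t p (X p) (Y p) (Z p) + g p (along X Y p) (Z p)"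
      using metric_product[OF p, of "X p" "Z p" "Y p"] metric_commute[OF p, of "Y p" "m p (X p) (Z p)"]
        tensor_commute[OF p] by (simp add: l)
    have "g p (Y p) (m p (X p) (Z p)) = t p (X p) (Y p) (Z p)"
      using metric_product[OF p, of "X p" "Z p" "Y p"] metric_commute[OF p, of "Y p" "m p (X p) (Z p)"]
        tensor_commute[OF p] by simp
    then show ?thesis
      by (simp add: metric_derivative_def * alpha_connection_eq[OF p] l metric_product[OF p] field_simps)
  qed
  have "riemannian_metric_on \<Theta> g"
    unfolding riemannian_metric_on_def
    using bilinear_metric metric_commute metric_pos smooth_metric by blast
  then show ?thesis
    using tensor_commute(1) by (simp add: compatible_metric_on_def nab_g)
qed

lemma symmetric_tensor3: "symmetric_tensor3_on \<Theta> t"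
  unfolding symmetric_tensor3_on_def using linear_tensor tensor_commute smooth_tensor by blast

lemma symmetric_product: "symmetric_product_on \<Theta> m"
  unfolding symmetric_product_on_def using bilinear_product product_commute smooth_product by blast

lemma associativity: "associativity_on \<Theta> g t m"
  unfolding associativity_on_def
proof (intro ballI allI conjI)
  fix p u v w assume p: "p \<in> \<Theta>"
  show "t p u v w = g p (m p u v) w" by (simp add: metric_product[OF p])
  have "g p u (m p v w) = t p v w u" by (simp add: metric_commute[OF p, of u] metric_product[OF p])
  then show "t p u v w = g p u (m p v w)" using tensor_commute[OF p] by metis
qed

section \<open>Affine charts of the connections with parameters 1 and -1\<close>

text \<open>The expectation parameters, up to sign, when \<open>\<psi>\<close> is a log-partition function.\<close>

definition gradient :: "real^'n \<Rightarrow> real^'n" where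
  "gradient p = (\<chi> i. pd (axis i 1) \<psi> p)"

lemma smooth_gradient: "smooth_on \<Theta> gradient"
  using smooth_pd_potential(1) by (intro smooth_on_vec open_domain) (simp add: gradient_def)

lemma inner_gradient: "p \<in> \<Theta> \<Longrightarrow> v \<bullet> gradient p = pd v \<psi> p"
  using pd_expand_axis[OF smooth_on_differentiable[OF smooth_potential], of p v]
  by (simp add: inner_vec_def gradient_def)

lemma pd_gradient:
  assumes "p \<in> \<Theta>"
  shows "pd v gradient p = gram g p *v v"
proof (rule vec_eq_iff[THEN iffD2], rule allI)
  fix i
  have "pd v gradient p $ i = pd v (\<lambda>q. gradient q $ i) p"
    using smooth_on_differentiable[OF smooth_gradient assms]
    by (simp add: pd_bounded_linear[OF bounded_linear_vec_nth])
  also have "\<dots> = g p v (axis i 1)"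
    by (simp add: gradient_def metric_eq[OF assms])
  finally show "pd v gradient p $ i = (gram g p *v v) $ i"
    by (simp add: gram_component[OF assms] metric_commute[OF assms, of v])
qed

lemma gram_bij: "p \<in> \<Theta> \<Longrightarrow> bij ((*v) (gram g p))"
  using gram_nondegenerate
  by (metis (no_types) bij_def det_nz_iff_inj_mult linear_injective_imp_surjective matrix_vector_mul_linear)

text \<open>The derivative of $v \cdot \nabla\psi$ along a segment in direction \<open>v\<close> is $g(v,v) > 0$. A ball is
  used because segments between its points stay inside.\<close>

lemma inj_on_gradient:
  assumes "ball p r \<subseteq> \<Theta>"
  shows "inj_on gradient (ball p r)"
proof (rule inj_onI, rule ccontr)
  fix a b assume ab: "a \<in> ball p r" "b \<in> ball p r" "gradient a = gradient b" "a \<noteq> b"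
  define v where "v = b - a"
  have seg: "a + x *\<^sub>R v \<in> \<Theta>" if "0 \<le> x" "x \<le> 1" for x
  proof -
    have "(1 - x) *\<^sub>R a + x *\<^sub>R b \<in> ball p r"
      using convex_ball[of p r] ab that unfolding convex_alt by auto
    then show ?thesis using assms by (auto simp: v_def algebra_simps)
  qed
  have "DERIV (\<lambda>x. pd v \<psi> (a + x *\<^sub>R v)) x :> g (a + x *\<^sub>R v) v v" if "0 \<le> x" "x \<le> 1" for x
    using DERIV_along_line[OF smooth_on_differentiable[OF smooth_pd_potential(1) seg[OF that]], of v]
    by (simp add: metric_eq[OF seg[OF that]])
  then obtain x where x: "0 < x" "x < 1"
      "pd v \<psi> (a + 1 *\<^sub>R v) - pd v \<psi> (a + 0 *\<^sub>R v) = (1 - 0) * g (a + x *\<^sub>R v) v v"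
    using MVT2[of 0 1 "\<lambda>x. pd v \<psi> (a + x *\<^sub>R v)" "\<lambda>x. g (a + x *\<^sub>R v) v v"] by auto
  have "v \<bullet> gradient b - v \<bullet> gradient a = g (a + x *\<^sub>R v) v v"
    using x seg[of 1] seg[of 0] by (simp add: inner_gradient v_def)
  moreover have "g (a + x *\<^sub>R v) v v > 0"
    using metric_pos[OF seg[of x], of v] x ab(4) by (simp add: v_def)
  ultimately show False using ab(3) by simp
qed

lemma affine_chart_ident: "affine_chart_on \<Theta> (alpha_connection (-1)) \<Theta> (\<lambda>p. p)"
proof -
  have "coord_field (\<lambda>p::real^'n. p) b = (\<lambda>p. axis b 1)" for b
    by (intro ext) (simp add: coord_field_def inv_id[unfolded id_def])
  then show ?thesis
    unfolding affine_chart_on_def using open_domain smooth_on_ident[of \<Theta>]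
    by (simp add: alpha_connection_eq along_def bij_id[unfolded id_def])
qed

lemma affine_chart_gradient:
  assumes ball: "ball p r \<subseteq> \<Theta>"
  shows "affine_chart_on \<Theta> (alpha_connection 1) (ball p r) gradient"
  unfolding affine_chart_on_def
proof (intro conjI ballI allI)
  show "smooth_on (ball p r) gradient" by (rule smooth_on_subset[OF smooth_gradient ball])
  have bij: "bij (frechet_derivative gradient (at q))" if "q \<in> ball p r" for q
  proof -
    have "frechet_derivative gradient (at q) = (*v) (gram g q)"
      using that ball by (intro ext pd_gradient) blast
    then show ?thesis using gram_bij that ball by auto
  qed
  then show "q \<in> ball p r \<Longrightarrow> bij (frechet_derivative gradient (at q))" for q .
  fix q a b assume q: "q \<in> ball p r"
  then have q': "q \<in> \<Theta>" using ball by blast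
  have parallel: "gram g q *v coord_field gradient b q = axis b 1" if "q \<in> ball p r" for q
    using coord_field_frechet_derivative[OF bij[OF that], of b] that ball
    by (simp add: pd_gradient subsetD)
  have "gram g q *v alpha_connection 1 (coord_field gradient a) (coord_field gradient b) q
      = along (coord_field gradient a) (\<lambda>q. gram g q *v coord_field gradient b q) q"
    using smooth_on_coord_field[OF open_ball smooth_on_subset[OF smooth_gradient ball] bij]
    by (intro along_gram[OF open_ball ball _ q, symmetric])
  also have "\<dots> = along (coord_field gradient a) (\<lambda>q. axis b 1) q"
    by (rule along_cong_open[OF open_ball q parallel])
  also have "\<dots> = gram g q *v 0" by (simp add: along_def)
  finally show "alpha_connection 1 (coord_field gradient a) (coord_field gradient b) q = 0"
    by (simp only: gram_eq_iff[OF q'])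
qed (use ball inj_on_gradient in auto)

lemma affine_flat_structure:
  assumes "\<alpha> = 1 \<or> \<alpha> = -1"
  shows "affine_flat_structure_on \<Theta> (alpha_connection \<alpha>)"
proof -
  have "\<exists>U x. p \<in> U \<and> affine_chart_on \<Theta> (alpha_connection \<alpha>) U x" if "p \<in> \<Theta>" for p
    using assms
  proof
    assume "\<alpha> = 1"
    obtain r where "r > 0" "ball p r \<subseteq> \<Theta>" using open_domain \<open>p \<in> \<Theta>\<close> open_contains_ball by blast
    then show ?thesis using affine_chart_gradient \<open>\<alpha> = 1\<close> centre_in_ball by blast
  next
    assume "\<alpha> = -1"
    then show ?thesis using affine_chart_ident \<open>p \<in> \<Theta>\<close> by blast
  qed
  moreover have "\<alpha>\<^sup>2 = 1" using assms by auto
  ultimately show ?thesis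
    by (simp add: affine_flat_structure_on_def affine_alpha_connection torsion_free_alpha_connection
        flat_alpha_connection)
qed

text \<open>A coordinate field is parallel in the directions of the coordinate fields, and these span.\<close>

lemma coord_field_parallel:
  assumes chart: "affine_chart_on \<Theta> (alpha_connection \<alpha>) U x" and q: "q \<in> U"
  shows "pd v (coord_field x b) q + ((1 + \<alpha>) / 2) *\<^sub>R m q v (coord_field x b q) = 0"
proof -
  let ?D = "frechet_derivative x (at q)"
  let ?L = "\<lambda>v. pd v (coord_field x b) q + ((1 + \<alpha>) / 2) *\<^sub>R m q v (coord_field x b q)"
  have U: "open U" "U \<subseteq> \<Theta>" "smooth_on U x" and bij: "\<And>p. p \<in> U \<Longrightarrow> bij (frechet_derivative x (at p))"
    using chart by (auto simp: affine_chart_on_def)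
  have q': "q \<in> \<Theta>" using U q by blast
  have "linear (\<lambda>v. m q v (coord_field x b q))"
    using bilinear_product[OF q'] by (simp add: bilinear_def)
  then have L: "linear ?L"
    by (intro linear_compose_add linear_compose_scale_right linear_frechet_derivative
          smooth_on_differentiable[OF smooth_on_coord_field[OF U(1,3) bij] q])
  \<comment> \<open>The left-hand side is linear in the direction, so it can be tested on a basis.\<close>
  have D: "linear (inv ?D)"
    using linear_frechet_derivative[OF smooth_on_differentiable[OF U(3) q]] bij[OF q]
    by (meson bij_is_inj bij_is_surj inj_linear_imp_inv_linear)
  have "?L (inv ?D (axis a 1)) = 0" for a
  proof -
    have "alpha_connection \<alpha> (coord_field x a) (coord_field x b) q = 0"
      using chart q by (simp add: affine_chart_on_def)
    then show ?thesis
      by (simp add: alpha_connection_eq[OF q'] along_def coord_field_def[of x a])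
  qed
  then have "?L (inv ?D w) = 0" for w
    using linear_expand_axis[OF linear_compose[OF D L, unfolded o_def], of w] by simp
  then have "?L (inv ?D (?D v)) = 0" .
  then show ?thesis using bij[OF q] by (simp add: bij_is_inj inv_f_f)
qed

lemma potentiality_minus_1: "potentiality_on \<Theta> (alpha_connection (-1)) t"
  unfolding potentiality_on_def
proof (intro allI impI ballI)
  fix U x p assume chart: "affine_chart_on \<Theta> (alpha_connection (-1)) U x" and p: "p \<in> U"
  let ?e = "coord_field x"
  have U: "open U" "U \<subseteq> \<Theta>" "smooth_on U x" and bij: "\<And>p. p \<in> U \<Longrightarrow> bij (frechet_derivative x (at p))"
    using chart by (auto simp: affine_chart_on_def)
  obtain r where r: "r > 0" "ball p r \<subseteq> U" using U p open_contains_ball by blast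
  have "\<exists>c. \<forall>q\<in>ball p r. ?e b q = c" for b
    using coord_field_parallel[OF chart] r(2)
    by (intro constant_on_ball smooth_on_subset[OF smooth_on_coord_field[OF U(1,3) bij] r(2)]) auto
  then obtain c where c: "\<And>b q. q \<in> ball p r \<Longrightarrow> ?e b q = c b" by metis
  have "t q (?e i q) (?e j q) (?e k q) = along (?e i) (along (?e j) (along (?e k) \<psi>)) q"
    if q: "q \<in> ball p r" for q i j k
  proof -
    have "along (?e k) \<psi> q' = pd (c k) \<psi> q'" if "q' \<in> ball p r" for q'
      using that by (simp add: along_def c)
    then have "along (?e j) (along (?e k) \<psi>) q' = pd (c j) (pd (c k) \<psi>) q'" if "q' \<in> ball p r" for q'
      using that by (subst along_cong_open[OF open_ball that]) (auto simp: along_def c)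
    then have "along (?e i) (along (?e j) (along (?e k) \<psi>)) q = pd (c i) (pd (c j) (pd (c k) \<psi>)) q"
      using q by (subst along_cong_open[OF open_ball q]) (auto simp: along_def c)
    then show ?thesis
      using q r(2) U(2) by (subst tensor_eq) (auto simp: c)
  qed
  then show "\<exists>V \<Phi>. open V \<and> p \<in> V \<and> V \<subseteq> U \<and> smooth_on V (\<Phi> :: real^'n \<Rightarrow> real) \<and>
      (\<forall>q\<in>V. \<forall>i j k. t q (?e i q) (?e j q) (?e k q) = along (?e i) (along (?e j) (along (?e k) \<Phi>)) q)"
    using r U(2) smooth_on_subset[OF smooth_potential, of "ball p r"]
    by (intro exI[of _ "ball p r"] exI[of _ \<psi>]) auto
qed

lemma potentiality_1: "potentiality_on \<Theta> (alpha_connection 1) t"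
  unfolding potentiality_on_def
proof (intro allI impI ballI)
  fix U x p assume chart: "affine_chart_on \<Theta> (alpha_connection 1) U x" and p: "p \<in> U"
  let ?e = "coord_field x"
  let ?\<Phi> = "\<lambda>q. \<psi> q - q \<bullet> gradient q"
  have U: "open U" "U \<subseteq> \<Theta>" "smooth_on U x" and bij: "\<And>p. p \<in> U \<Longrightarrow> bij (frechet_derivative x (at p))"
    using chart by (auto simp: affine_chart_on_def)
  obtain r where r: "r > 0" "ball p r \<subseteq> U" using U p open_contains_ball by blast
  have ball: "ball p r \<subseteq> \<Theta>" using r(2) U(2) by blast
  have e: "smooth_on (ball p r) (?e b)" for b
    by (rule smooth_on_subset[OF smooth_on_coord_field[OF U(1,3) bij] r(2)])
  have De: "pd v (?e b) q = - m q v (?e b q)" if "q \<in> ball p r" for v b q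
    using coord_field_parallel[OF chart, where v = v and b = b] that r(2) by (auto simp: eq_neg_iff_add_eq_0)
  have "\<exists>c. \<forall>q\<in>ball p r. gram g q *v ?e b q = c" for b
    by (intro constant_on_ball smooth_gram[OF open_ball ball e])
       (simp add: pd_gram[OF open_ball ball e] De)
  then obtain c where c: "\<And>b q. q \<in> ball p r \<Longrightarrow> gram g q *v ?e b q = c b" by metis
  have \<Phi>: "smooth_on \<Theta> ?\<Phi>"
    by (intro smooth_on_diff smooth_on_inner smooth_on_ident smooth_gradient smooth_potential open_domain)
  \<comment> \<open>A Legendre dual of \<open>\<psi>\<close>: its derivative along \<open>v\<close> is \<open>- q \<bullet> (G v)\<close>, which is affine
  in \<open>q\<close> when \<open>G v\<close> is constant, as it is for coordinate fields.\<close>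
  have D\<Phi>: "pd v ?\<Phi> q = - (q \<bullet> (gram g q *v v))" if "q \<in> \<Theta>" for q v
  proof -
    have "(?\<Phi> has_derivative (\<lambda>v. pd v \<psi> q - (q \<bullet> pd v gradient q + v \<bullet> gradient q))) (at q)"
      using that smooth_potential smooth_gradient
      by (intro has_derivative_diff has_derivative_inner has_derivative_ident has_frechet_derivative
            smooth_on_differentiable[of \<Theta>])
    from pd_eqI[OF this] show ?thesis
      by (simp add: inner_gradient[OF that] pd_gradient[OF that])
  qed
  have "t q (?e i q) (?e j q) (?e k q) = along (?e i) (along (?e j) (along (?e k) ?\<Phi>)) q"
    if q: "q \<in> ball p r" for q i j k
  proof -
    have D1: "along (?e k) ?\<Phi> q' = - (q' \<bullet> c k)" if "q' \<in> ball p r" for q'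
      using that ball by (subst along_def) (simp add: D\<Phi> c subsetD)
    have D2: "along (?e j) (along (?e k) ?\<Phi>) q' = - (?e j q' \<bullet> c k)" if "q' \<in> ball p r" for q'
    proof -
      have "((\<lambda>q. - (q \<bullet> c k)) has_derivative (\<lambda>v. - (v \<bullet> c k))) (at q')"
        by (auto intro!: derivative_eq_intros)
      then show ?thesis
        by (subst along_cong_open[OF open_ball that D1]) (simp_all add: along_def pd_eqI)
    qed
    have "((\<lambda>q. - (?e j q \<bullet> c k)) has_derivative (\<lambda>v. - (pd v (?e j) q \<bullet> c k))) (at q)"
      by (intro has_derivative_minus has_derivative_inner_left has_frechet_derivative
            smooth_on_differentiable[OF e q])
    then have "along (?e i) (along (?e j) (along (?e k) ?\<Phi>)) q = - (pd (?e i q) (?e j) q \<bullet> c k)"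
      by (subst along_cong_open[OF open_ball q D2]) (simp_all add: along_def pd_eqI)
    also have "\<dots> = g q (m q (?e i q) (?e j q)) (?e k q)"
      using q ball by (simp add: De flip: c) (simp add: inner_gram subsetD)
    also have "\<dots> = t q (?e i q) (?e j q) (?e k q)"
      using q ball by (simp add: metric_product subsetD)
    finally show ?thesis by simp
  qed
  then show "\<exists>V \<Phi>. open V \<and> p \<in> V \<and> V \<subseteq> U \<and> smooth_on V (\<Phi> :: real^'n \<Rightarrow> real) \<and>
      (\<forall>q\<in>V. \<forall>i j k. t q (?e i q) (?e j q) (?e k q) = along (?e i) (along (?e j) (along (?e k) \<Phi>)) q)"
    using r smooth_on_subset[OF \<Phi> ball]
    by (intro exI[of _ "ball p r"] exI[of _ ?\<Phi>]) auto
qed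

lemma frobenius_alpha_connection:
  assumes "\<alpha> = 1 \<or> \<alpha> = -1"
  shows "frobenius_manifold \<Theta> (alpha_connection \<alpha>) g t m"
  using assms affine_flat_structure[OF assms] potentiality_1 potentiality_minus_1
  by (auto simp: frobenius_manifold_def pre_frobenius_manifold_def open_domain associativity
      compatible_alpha_connection symmetric_tensor3 symmetric_product)

lemma frobenius_alpha_connection_iff:
  assumes "\<not> flat_on \<Theta> (levi_civita g)"
  shows "frobenius_manifold \<Theta> (alpha_connection \<alpha>) g t m \<longleftrightarrow> \<alpha> = 1 \<or> \<alpha> = -1"
proof
  assume "frobenius_manifold \<Theta> (alpha_connection \<alpha>) g t m"
  then have "flat_on \<Theta> (alpha_connection \<alpha>)"
    by (simp add: frobenius_manifold_def pre_frobenius_manifold_def affine_flat_structure_on_def)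
  then have "\<alpha>\<^sup>2 = 1" using flat_levi_civita assms by blast
  then show "\<alpha> = 1 \<or> \<alpha> = -1" by (simp add: power2_eq_1_iff)
qed (rule frobenius_alpha_connection)

lemma flat_levi_civitaD:
  assumes "flat_on \<Theta> (levi_civita g)" "p \<in> \<Theta>"
  shows "m p u (m p v w) = m p v (m p u w)"
proof -
  have "curvature (alpha_connection 0) (\<lambda>_. u) (\<lambda>_. v) (\<lambda>_. w) p = 0"
    using assms smooth_on_const unfolding flat_on_def levi_civita_eq by blast
  then show ?thesis
    by (simp add: curvature_alpha_connection smooth_on_const assms(2))
qed

end

section \<open>The Hessian structure of an exponential family\<close>

text \<open>The exponential factor pays for large arguments: statistics are unbounded, and the remainder of
  a moment has to be estimated at every sample point.\<close>

lemma exp_remainder_le: "\<bar>exp y - 1 - y\<bar> \<le> y\<^sup>2 * exp \<bar>y\<bar>" for y :: real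
proof -
  have "exp y * (1 - y) \<le> exp y * exp (- y)"
    using exp_ge_add_one_self[of "- y"] by (intro mult_left_mono) auto
  then have *: "exp y - 1 \<le> y * exp y" by (simp add: exp_minus algebra_simps)
  have "exp y - 1 - y \<le> y\<^sup>2 * exp \<bar>y\<bar>"
  proof (cases "y \<ge> 0")
    case True
    then have "y * (exp y - 1) \<le> y * (y * exp y)" using * by (intro mult_left_mono)
    then show ?thesis using True * by (simp add: power2_eq_square algebra_simps)
  next
    case False
    have "1 - exp y \<le> - y" using exp_ge_add_one_self[of y] by linarith
    then have "(- y) * (1 - exp y) \<le> (- y) * (- y)"
      using False by (intro mult_left_mono) auto
    also have "\<dots> \<le> y\<^sup>2 * exp \<bar>y\<bar>"
      by (simp add: power2_eq_square mult_le_cancel_left1)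
    finally show ?thesis using * by (simp add: algebra_simps)
  qed
  then show ?thesis using exp_ge_add_one_self[of y] by linarith
qed

locale exp_family =
  fixes M :: "'a measure" and X :: "'n::finite \<Rightarrow> 'a \<Rightarrow> real"
  assumes exponential_family: "exponential_family M X"
begin

text \<open>The sufficient statistic of the family.\<close>

definition T :: "'a \<Rightarrow> real^'n" where
  "T \<omega> = (\<chi> j. X j \<omega>)"

lemma inner_T: "\<beta> \<bullet> T \<omega> = (\<Sum>j\<in>UNIV. \<beta> $ j * X j \<omega>)"
  by (simp add: T_def inner_vec_def)

lemma measurable_T [measurable]: "T \<in> borel_measurable M"
proof (subst borel_measurable_euclidean_space, intro ballI)
  fix b :: "real^'n" assume "b \<in> Basis"
  have "(\<lambda>\<omega>. \<Sum>j\<in>UNIV. b $ j * X j \<omega>) \<in> borel_measurable M"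
    using exponential_family by (intro borel_measurable_sum borel_measurable_times) (auto simp: exponential_family_def)
  then show "(\<lambda>\<omega>. T \<omega> \<bullet> b) \<in> borel_measurable M"
    by (simp add: inner_commute[of _ b] inner_T)
qed

abbreviation \<Theta> :: "(real^'n) set" where
  "\<Theta> \<equiv> parameters M X"

lemma open_\<Theta>: "open \<Theta>"
  by (simp add: parameters_def)

lemma linearly_independent:
  assumes "AE \<omega> in M. c\<^sub>0 + c \<bullet> T \<omega> = 0"
  shows "c\<^sub>0 = 0" "c = 0"
  using assms exponential_family unfolding exponential_family_def inner_T by blast+

text \<open>Integrands that may be differentiated under the integral sign at every interior parameter. The
  bound has to hold for every \<open>r\<close> because the distance from a parameter to the boundary of the domain
  can be arbitrarily small.\<close>

definition subexponential :: "('a \<Rightarrow> real) \<Rightarrow> bool" where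
  "subexponential h \<longleftrightarrow> h \<in> borel_measurable M \<and> (\<forall>r>0. \<exists>C. \<forall>\<omega>. \<bar>h \<omega>\<bar> \<le> C * exp (r * norm (T \<omega>)))"

lemma subexponential_measurable: "subexponential h \<Longrightarrow> h \<in> borel_measurable M"
  by (simp add: subexponential_def)

lemma subexponential_norm_T: "subexponential (\<lambda>\<omega>. norm (T \<omega>))"
  unfolding subexponential_def
proof (intro conjI allI impI)
  fix r :: real assume "r > 0"
  have "\<bar>norm (T \<omega>)\<bar> \<le> (1 / r) * exp (r * norm (T \<omega>))" for \<omega>
  proof -
    have "r * norm (T \<omega>) \<le> exp (r * norm (T \<omega>))"
      using exp_ge_add_one_self[of "r * norm (T \<omega>)"] by linarith
    then show ?thesis using \<open>r > 0\<close> by (simp add: field_simps)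
  qed
  then show "\<exists>C. \<forall>\<omega>. \<bar>norm (T \<omega>)\<bar> \<le> C * exp (r * norm (T \<omega>))" by blast
qed measurable

lemma subexponential_const: "subexponential (\<lambda>\<omega>. c)"
  unfolding subexponential_def
proof (intro conjI allI impI)
  fix r :: real assume "r > 0"
  have "\<bar>c\<bar> \<le> \<bar>c\<bar> * exp (r * norm (T \<omega>))" for \<omega>
    using \<open>r > 0\<close> by (simp add: mult_le_cancel_left1)
  then show "\<exists>C. \<forall>\<omega>. \<bar>c\<bar> \<le> C * exp (r * norm (T \<omega>))" by blast
qed measurable

lemma subexponential_mult:
  assumes "subexponential f" "subexponential h"
  shows "subexponential (\<lambda>\<omega>. f \<omega> * h \<omega>)"
  unfolding subexponential_def
proof (intro conjI allI impI)
  show "(\<lambda>\<omega>. f \<omega> * h \<omega>) \<in> borel_measurable M"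
    using assms by (intro borel_measurable_times subexponential_measurable)
  fix r :: real assume "r > 0"
  then obtain C D where C: "\<And>\<omega>. \<bar>f \<omega>\<bar> \<le> C * exp (r / 2 * norm (T \<omega>))"
    and D: "\<And>\<omega>. \<bar>h \<omega>\<bar> \<le> D * exp (r / 2 * norm (T \<omega>))"
    using assms unfolding subexponential_def by (meson half_gt_zero)
  have "\<bar>f \<omega> * h \<omega>\<bar> \<le> (C * D) * exp (r * norm (T \<omega>))" for \<omega>
  proof -
    have "\<bar>f \<omega>\<bar> * \<bar>h \<omega>\<bar> \<le> (C * exp (r / 2 * norm (T \<omega>))) * (D * exp (r / 2 * norm (T \<omega>)))"
      by (intro mult_mono C D order_trans[OF abs_ge_zero C]) simp
    also have "\<dots> = (C * D) * (exp (r / 2 * norm (T \<omega>)) * exp (r / 2 * norm (T \<omega>)))"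
      by (simp add: mult_ac)
    also have "exp (r / 2 * norm (T \<omega>)) * exp (r / 2 * norm (T \<omega>)) = exp (r * norm (T \<omega>))"
      by (simp add: exp_add[symmetric])
    finally show ?thesis by (simp add: abs_mult)
  qed
  then show "\<exists>C. \<forall>\<omega>. \<bar>f \<omega> * h \<omega>\<bar> \<le> C * exp (r * norm (T \<omega>))" by blast
qed

lemma subexponential_add:
  assumes "subexponential f" "subexponential h"
  shows "subexponential (\<lambda>\<omega>. f \<omega> + h \<omega>)"
  unfolding subexponential_def
proof (intro conjI allI impI)
  show "(\<lambda>\<omega>. f \<omega> + h \<omega>) \<in> borel_measurable M"
    using assms by (intro borel_measurable_add subexponential_measurable)
  fix r :: real assume "r > 0"
  then obtain C D where C: "\<And>\<omega>. \<bar>f \<omega>\<bar> \<le> C * exp (r * norm (T \<omega>))"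
    and D: "\<And>\<omega>. \<bar>h \<omega>\<bar> \<le> D * exp (r * norm (T \<omega>))"
    using assms unfolding subexponential_def by meson
  have "\<bar>f \<omega> + h \<omega>\<bar> \<le> (C + D) * exp (r * norm (T \<omega>))" for \<omega>
    using C[of \<omega>] D[of \<omega>] by (simp add: distrib_right)
  then show "\<exists>C. \<forall>\<omega>. \<bar>f \<omega> + h \<omega>\<bar> \<le> C * exp (r * norm (T \<omega>))" by blast
qed

lemma subexponential_bounded:
  assumes "f \<in> borel_measurable M" "subexponential h" "\<And>\<omega>. \<bar>f \<omega>\<bar> \<le> \<bar>h \<omega>\<bar>"
  shows "subexponential f"
  using assms unfolding subexponential_def by (meson order_trans)

lemma subexponential_inner_T: "subexponential (\<lambda>\<omega>. v \<bullet> T \<omega>)"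
  by (rule subexponential_bounded[OF _ subexponential_mult[OF subexponential_const[of "norm v"] subexponential_norm_T]])
     (simp_all add: abs_mult Cauchy_Schwarz_ineq2[of v])

lemma subexponential_diff:
  assumes "subexponential f" "subexponential h"
  shows "subexponential (\<lambda>\<omega>. f \<omega> - h \<omega>)"
  using subexponential_add[OF assms(1) subexponential_mult[OF subexponential_const assms(2), of "-1"]]
  by simp

lemmas subexponential_intros = subexponential_const subexponential_inner_T subexponential_norm_T
  subexponential_add subexponential_diff subexponential_mult

text \<open>The norm of \<open>T\<close> is at most \<open>n\<close> times the absolute value of one coordinate of \<open>T\<close>, so
  $e^{r|T|}$ is dominated by the sum over \<open>j\<close> of $e^{rnT_j} + e^{-rnT_j}$. Each of these terms
  moves the parameter by \<open>\<plusminus> rn\<close> along an axis, which stays inside the natural domain for small \<open>r\<close>.\<close>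

lemma integrable_exp_norm:
  assumes "\<beta> \<in> \<Theta>"
  shows "\<exists>r>0. integrable M (\<lambda>\<omega>. exp (r * norm (T \<omega>)) * exp (- (\<beta> \<bullet> T \<omega>)))"
proof -
  let ?N = "real CARD('n)"
  obtain \<epsilon> where \<epsilon>: "\<epsilon> > 0" "ball \<beta> \<epsilon> \<subseteq> natural_domain M X"
    using assms unfolding parameters_def mem_interior by blast
  define r where "r = \<epsilon> / (2 * ?N)"
  define s where "s = r * ?N"
  have r: "r > 0" using \<epsilon> by (simp add: r_def)
  have s: "s > 0" "s < \<epsilon>" using \<epsilon> by (simp_all add: s_def r_def)
  have near: "integrable M (\<lambda>\<omega>. exp (- ((\<beta> + \<sigma> *\<^sub>R axis j 1) \<bullet> T \<omega>)))" if "\<bar>\<sigma>\<bar> = s" for \<sigma> and j :: 'n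
  proof -
    have "\<beta> + \<sigma> *\<^sub>R axis j 1 \<in> ball \<beta> \<epsilon>" using that s by (simp add: dist_norm)
    then show ?thesis using \<epsilon>(2) by (auto simp: natural_domain_def inner_T)
  qed
  let ?B = "\<lambda>\<omega>. \<Sum>j\<in>UNIV. exp (- ((\<beta> + (- s) *\<^sub>R axis j 1) \<bullet> T \<omega>)) + exp (- ((\<beta> + s *\<^sub>R axis j 1) \<bullet> T \<omega>))"
  have "exp (r * norm (T \<omega>)) * exp (- (\<beta> \<bullet> T \<omega>)) \<le> ?B \<omega>" for \<omega>
  proof -
    obtain j where j: "\<And>i. \<bar>T \<omega> $ i\<bar> \<le> \<bar>T \<omega> $ j\<bar>"
    proof -
      let ?A = "range (\<lambda>i. \<bar>T \<omega> $ i\<bar>)"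
      have "Max ?A \<in> ?A" by (rule Max_in) auto
      then obtain j where j: "Max ?A = \<bar>T \<omega> $ j\<bar>" by blast
      show thesis
      proof (rule that)
        show "\<bar>T \<omega> $ i\<bar> \<le> \<bar>T \<omega> $ j\<bar>" for i
          unfolding j[symmetric] by (rule Max_ge) auto
      qed
    qed
    have "norm (T \<omega>) \<le> (\<Sum>i\<in>UNIV. \<bar>T \<omega> $ i\<bar>)" by (rule norm_le_l1_cart)
    also have "\<dots> \<le> (\<Sum>i\<in>(UNIV::'n set). \<bar>T \<omega> $ j\<bar>)" by (intro sum_mono j)
    finally have "r * norm (T \<omega>) \<le> s * \<bar>T \<omega> $ j\<bar>" using r by (simp add: s_def mult_left_mono)
    then have "exp (r * norm (T \<omega>)) \<le> exp (s * \<bar>T \<omega> $ j\<bar>)" by simp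
    also have "\<dots> \<le> exp (s * T \<omega> $ j) + exp (- (s * T \<omega> $ j))"
      by (cases "T \<omega> $ j \<ge> 0") simp_all
    finally have "exp (r * norm (T \<omega>)) * exp (- (\<beta> \<bullet> T \<omega>))
        \<le> (exp (s * T \<omega> $ j) + exp (- (s * T \<omega> $ j))) * exp (- (\<beta> \<bullet> T \<omega>))"
      by (intro mult_right_mono) auto
    also have "\<dots> = exp (- ((\<beta> + (- s) *\<^sub>R axis j 1) \<bullet> T \<omega>)) + exp (- ((\<beta> + s *\<^sub>R axis j 1) \<bullet> T \<omega>))"
      by (simp add: distrib_right exp_add[symmetric] inner_diff_left inner_add_left inner_axis')
    also have "\<dots> \<le> ?B \<omega>" by (rule member_le_sum[of j UNIV]) auto
    finally show ?thesis .
  qed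
  then have bound: "norm (exp (r * norm (T \<omega>)) * exp (- (\<beta> \<bullet> T \<omega>))) \<le> norm (?B \<omega>)" for \<omega>
    unfolding real_norm_def abs_of_nonneg[OF mult_nonneg_nonneg[OF exp_ge_zero exp_ge_zero]]
    by (rule order_trans[OF _ abs_ge_self])
  have "integrable M ?B"
    using near[of "- s"] near[of s] s
    by (intro Bochner_Integration.integrable_sum Bochner_Integration.integrable_add) simp_all
  then have "integrable M (\<lambda>\<omega>. exp (r * norm (T \<omega>)) * exp (- (\<beta> \<bullet> T \<omega>)))"
  proof (rule Bochner_Integration.integrable_bound)
    show "(\<lambda>\<omega>. exp (r * norm (T \<omega>)) * exp (- (\<beta> \<bullet> T \<omega>))) \<in> borel_measurable M"
      by measurable
  qed (rule AE_I2, rule bound)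
  then show ?thesis using r by blast
qed

lemma integrable_subexponential_exp_norm:
  assumes "\<beta> \<in> \<Theta>" "subexponential h"
  shows "\<exists>r>0. integrable M (\<lambda>\<omega>. \<bar>h \<omega>\<bar> * exp (r * norm (T \<omega>)) * exp (- (\<beta> \<bullet> T \<omega>)))"
proof -
  obtain r where r: "r > 0" "integrable M (\<lambda>\<omega>. exp (r * norm (T \<omega>)) * exp (- (\<beta> \<bullet> T \<omega>)))"
    using integrable_exp_norm[OF assms(1)] by blast
  obtain C where C: "\<And>\<omega>. \<bar>h \<omega>\<bar> \<le> C * exp (r / 2 * norm (T \<omega>))"
    using assms(2) r(1) unfolding subexponential_def by (meson half_gt_zero)
  have h[measurable]: "h \<in> borel_measurable M" by (rule subexponential_measurable[OF assms(2)])
  have "\<bar>h \<omega>\<bar> * exp (r / 2 * norm (T \<omega>)) * exp (- (\<beta> \<bullet> T \<omega>))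
      \<le> C * (exp (r * norm (T \<omega>)) * exp (- (\<beta> \<bullet> T \<omega>)))" for \<omega>
  proof -
    have "\<bar>h \<omega>\<bar> * exp (r / 2 * norm (T \<omega>)) * exp (- (\<beta> \<bullet> T \<omega>))
        \<le> C * exp (r / 2 * norm (T \<omega>)) * exp (r / 2 * norm (T \<omega>)) * exp (- (\<beta> \<bullet> T \<omega>))"
      by (intro mult_right_mono C) auto
    also have "\<dots> = C * (exp (r / 2 * norm (T \<omega>) + r / 2 * norm (T \<omega>)) * exp (- (\<beta> \<bullet> T \<omega>)))"
      by (simp only: exp_add mult_ac)
    finally show ?thesis by simp
  qed
  then have "\<bar>\<bar>h \<omega>\<bar> * exp (r / 2 * norm (T \<omega>)) * exp (- (\<beta> \<bullet> T \<omega>))\<bar>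
      \<le> \<bar>C * (exp (r * norm (T \<omega>)) * exp (- (\<beta> \<bullet> T \<omega>)))\<bar>" for \<omega>
    by (smt (verit) exp_ge_zero mult_nonneg_nonneg)
  then have "integrable M (\<lambda>\<omega>. \<bar>h \<omega>\<bar> * exp (r / 2 * norm (T \<omega>)) * exp (- (\<beta> \<bullet> T \<omega>)))"
    by (intro Bochner_Integration.integrable_bound[OF integrable_mult_right[OF r(2), of C]] AE_I2)
       (auto simp: abs_mult)
  then show ?thesis using r(1) half_gt_zero by blast
qed

lemma integrable_subexponential:
  assumes "\<beta> \<in> \<Theta>" "subexponential h"
  shows "integrable M (\<lambda>\<omega>. h \<omega> * exp (- (\<beta> \<bullet> T \<omega>)))"
proof -
  obtain r where r: "r > 0" "integrable M (\<lambda>\<omega>. \<bar>h \<omega>\<bar> * exp (r * norm (T \<omega>)) * exp (- (\<beta> \<bullet> T \<omega>)))"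
    using integrable_subexponential_exp_norm[OF assms] by blast
  have [measurable]: "h \<in> borel_measurable M" by (rule subexponential_measurable[OF assms(2)])
  have "\<bar>h \<omega>\<bar> * exp (- (\<beta> \<bullet> T \<omega>)) \<le> \<bar>h \<omega>\<bar> * exp (r * norm (T \<omega>)) * exp (- (\<beta> \<bullet> T \<omega>))" for \<omega>
    using r(1) by (intro mult_right_mono) (simp_all add: mult_le_cancel_left1)
  then show ?thesis
    by (intro Bochner_Integration.integrable_bound[OF r(2)] AE_I2) (auto simp: abs_mult)
qed

definition moment :: "('a \<Rightarrow> real) \<Rightarrow> real^'n \<Rightarrow> real" where
  "moment h \<beta> = (\<integral>\<omega>. h \<omega> * exp (- (\<beta> \<bullet> T \<omega>)) \<partial>M)"

lemma moment_add:
  "\<lbrakk>\<beta> \<in> \<Theta>; subexponential f; subexponential h\<rbrakk> \<Longrightarrow> moment (\<lambda>\<omega>. f \<omega> + h \<omega>) \<beta> = moment f \<beta> + moment h \<beta>"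
  by (simp add: moment_def distrib_right integrable_subexponential)

lemma moment_cmult: "moment (\<lambda>\<omega>. c * f \<omega>) \<beta> = c * moment f \<beta>"
  by (simp add: moment_def mult.assoc)

text \<open>For $|v| \le r$ the Taylor remainder of the integrand is at most
  $|v|^2\,|T|^2\,|h|\,e^{r|T|}e^{-\beta\cdot T}$, whose integral is finite by the growth condition
  on \<open>h\<close>. So the remainder of the integral is of order $|v|^2$.\<close>

lemma moment_has_derivative:
  assumes \<beta>: "\<beta> \<in> \<Theta>" and h: "subexponential h"
  shows "(moment h has_derivative (\<lambda>v. - moment (\<lambda>\<omega>. (v \<bullet> T \<omega>) * h \<omega>) \<beta>)) (at \<beta>)"
proof -
  let ?D = "\<lambda>v. - moment (\<lambda>\<omega>. (v \<bullet> T \<omega>) * h \<omega>) \<beta>"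
  have vh: "subexponential (\<lambda>\<omega>. (v \<bullet> T \<omega>) * h \<omega>)" for v
    by (intro subexponential_intros h)
  have "linear ?D"
  proof (rule linearI)
    show "?D (u + v) = ?D u + ?D v" for u v
      using moment_add[OF \<beta> vh vh, of u v] by (simp only: inner_add_left distrib_right minus_add_distrib)
    show "?D (c *\<^sub>R v) = c *\<^sub>R ?D v" for c v
      using moment_cmult[of c "\<lambda>\<omega>. (v \<bullet> T \<omega>) * h \<omega>"] by (simp add: mult.assoc[of c])
  qed
  then have lin: "bounded_linear ?D" by (simp add: linear_conv_bounded_linear)
  obtain r where r: "r > 0"
    and int: "integrable M (\<lambda>\<omega>. \<bar>norm (T \<omega>) * norm (T \<omega>) * h \<omega>\<bar> * exp (r * norm (T \<omega>)) * exp (- (\<beta> \<bullet> T \<omega>)))"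
    using integrable_subexponential_exp_norm[OF \<beta> subexponential_mult[OF subexponential_mult[OF
          subexponential_norm_T subexponential_norm_T] h]] by auto
  define F where "F \<omega> = \<bar>norm (T \<omega>) * norm (T \<omega>) * h \<omega>\<bar> * exp (r * norm (T \<omega>)) * exp (- (\<beta> \<bullet> T \<omega>))" for \<omega>
  define K where "K = (\<integral>\<omega>. F \<omega> \<partial>M)"
  obtain \<epsilon> where \<epsilon>: "\<epsilon> > 0" "ball \<beta> \<epsilon> \<subseteq> \<Theta>" using open_\<Theta> \<beta> open_contains_ball by blast
  have remainder: "\<bar>moment h (\<beta> + v) - moment h \<beta> - ?D v\<bar> \<le> K * (norm v)\<^sup>2"
    if v: "norm v < min r \<epsilon>" for v
  proof -
    have v\<Theta>: "\<beta> + v \<in> \<Theta>" using \<epsilon>(2) v by (auto simp: dist_norm)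
    let ?R = "\<lambda>\<omega>. h \<omega> * exp (- ((\<beta> + v) \<bullet> T \<omega>)) - h \<omega> * exp (- (\<beta> \<bullet> T \<omega>))
        + (v \<bullet> T \<omega>) * h \<omega> * exp (- (\<beta> \<bullet> T \<omega>))"
    have i: "integrable M (\<lambda>\<omega>. h \<omega> * exp (- ((\<beta> + v) \<bullet> T \<omega>)))"
        "integrable M (\<lambda>\<omega>. h \<omega> * exp (- (\<beta> \<bullet> T \<omega>)))"
        "integrable M (\<lambda>\<omega>. (v \<bullet> T \<omega>) * h \<omega> * exp (- (\<beta> \<bullet> T \<omega>)))"
      by (rule integrable_subexponential[OF v\<Theta> h] integrable_subexponential[OF \<beta> h]
            integrable_subexponential[OF \<beta> vh])+
    have "moment h (\<beta> + v) - moment h \<beta> - ?D v = (\<integral>\<omega>. ?R \<omega> \<partial>M)"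
      using i by (simp add: moment_def)
    also have "\<bar>\<dots>\<bar> \<le> (\<integral>\<omega>. (norm v)\<^sup>2 * F \<omega> \<partial>M)"
    proof (rule integral_abs_bound[THEN order_trans], rule integral_mono)
      show "integrable M (\<lambda>\<omega>. \<bar>?R \<omega>\<bar>)"
        using i by (intro integrable_abs Bochner_Integration.integrable_add Bochner_Integration.integrable_diff)
      show "integrable M (\<lambda>\<omega>. (norm v)\<^sup>2 * F \<omega>)"
        by (rule integrable_mult_right[OF int[folded F_def]])
      fix \<omega>
      let ?y = "- (v \<bullet> T \<omega>)"
      have vT: "\<bar>?y\<bar> \<le> norm v * norm (T \<omega>)" using Cauchy_Schwarz_ineq2[of v "T \<omega>"] by simp
      have "\<bar>exp ?y - 1 - ?y\<bar> \<le> ?y\<^sup>2 * exp \<bar>?y\<bar>" by (rule exp_remainder_le)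
      also have "\<dots> \<le> (norm v * norm (T \<omega>))\<^sup>2 * exp (r * norm (T \<omega>))"
      proof (rule mult_mono)
        show "?y\<^sup>2 \<le> (norm v * norm (T \<omega>))\<^sup>2"
          using power_mono[OF vT, of 2] by simp
        have "norm v * norm (T \<omega>) \<le> r * norm (T \<omega>)" using v by (intro mult_right_mono) auto
        then show "exp \<bar>?y\<bar> \<le> exp (r * norm (T \<omega>))" using vT by simp
      qed auto
      finally have le: "\<bar>exp ?y - 1 - ?y\<bar> \<le> (norm v * norm (T \<omega>))\<^sup>2 * exp (r * norm (T \<omega>))" .
      have "exp (- ((\<beta> + v) \<bullet> T \<omega>)) = exp (- (\<beta> \<bullet> T \<omega>)) * exp ?y"
        by (simp add: inner_add_left exp_add[symmetric])
      then have "?R \<omega> = h \<omega> * exp (- (\<beta> \<bullet> T \<omega>)) * (exp ?y - 1 - ?y)"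
        by (simp only: right_diff_distrib diff_minus_eq_add distrib_left mult_1_right mult_ac minus_minus)
      then have "\<bar>?R \<omega>\<bar> = \<bar>h \<omega>\<bar> * exp (- (\<beta> \<bullet> T \<omega>)) * \<bar>exp ?y - 1 - ?y\<bar>"
        by (simp add: abs_mult)
      also have "\<dots> \<le> \<bar>h \<omega>\<bar> * exp (- (\<beta> \<bullet> T \<omega>)) * ((norm v * norm (T \<omega>))\<^sup>2 * exp (r * norm (T \<omega>)))"
        by (intro mult_left_mono le) auto
      finally show "\<bar>?R \<omega>\<bar> \<le> (norm v)\<^sup>2 * F \<omega>"
        by (simp only: F_def abs_mult power_mult_distrib abs_norm_cancel power2_eq_square mult_ac)
    qed
    also have "\<dots> = K * (norm v)\<^sup>2"
      by (simp add: K_def mult.commute)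
    finally show ?thesis .
  qed
  have "((\<lambda>v. norm (moment h (\<beta> + v) - moment h \<beta> - ?D v) / norm v) \<longlongrightarrow> 0) (at 0)"
  proof (rule Lim_null_comparison[where g = "\<lambda>v. K * norm v"])
    have "\<forall>\<^sub>F v in at 0. norm v < min r \<epsilon>"
      using r \<epsilon>(1) unfolding eventually_at by (intro exI[of _ "min r \<epsilon>"]) (auto simp: dist_norm)
    then show "\<forall>\<^sub>F v in at 0. norm (norm (moment h (\<beta> + v) - moment h \<beta> - ?D v) / norm v) \<le> K * norm v"
    proof eventually_elim
      case (elim v)
      show ?case
        using remainder[OF elim] by (cases "v = 0") (auto simp: divide_le_eq power2_eq_square mult.assoc)
    qed
    show "((\<lambda>v. K * norm v) \<longlongrightarrow> 0) (at 0)"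
      by (intro tendsto_mult_right_zero tendsto_norm_zero tendsto_ident_at)
  qed
  then show ?thesis using lin unfolding has_derivative_at by blast
qed

lemma pd_moment:
  "\<lbrakk>\<beta> \<in> \<Theta>; subexponential h\<rbrakk> \<Longrightarrow> pd v (moment h) \<beta> = - moment (\<lambda>\<omega>. (v \<bullet> T \<omega>) * h \<omega>) \<beta>"
  by (rule pd_eqI[OF moment_has_derivative])

lemma smooth_moment: "subexponential h \<Longrightarrow> smooth_on \<Theta> (moment h)"
  unfolding smooth_on_def
proof
  show "subexponential h \<Longrightarrow> times_differentiable_on k (moment h) \<Theta>" for k
  proof (induction k arbitrary: h)
    case 0
    then show ?case
      using has_derivative_continuous[OF moment_has_derivative]
      by (auto intro!: continuous_at_imp_continuous_on)
  next
    case (Suc k)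
    have "times_differentiable_on k (pd v (moment h)) \<Theta>" for v
    proof (rule times_differentiable_on_cong[OF open_\<Theta>])
      show "- moment (\<lambda>\<omega>. (v \<bullet> T \<omega>) * h \<omega>) \<beta> = pd v (moment h) \<beta>" if "\<beta> \<in> \<Theta>" for \<beta>
        using pd_moment[OF that Suc.prems] by simp
      show "times_differentiable_on k (\<lambda>\<beta>. - moment (\<lambda>\<omega>. (v \<bullet> T \<omega>) * h \<omega>) \<beta>) \<Theta>"
        by (intro times_differentiable_on_bounded_linear[OF bounded_linear_minus[OF bounded_linear_ident]]
              open_\<Theta> Suc.IH subexponential_intros Suc.prems)
    qed
    then show ?case using differentiableI[OF moment_has_derivative[OF _ Suc.prems]] by simp
  qed
qed

abbreviation Z :: "real^'n \<Rightarrow> real" where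
  "Z \<equiv> moment (\<lambda>_. 1)"

lemma moment_eq_0:
  assumes "\<beta> \<in> \<Theta>" "subexponential h" "\<And>\<omega>. h \<omega> \<ge> 0" "moment h \<beta> = 0"
  shows "AE \<omega> in M. h \<omega> = 0"
  using integral_nonneg_eq_0_iff_AE[OF integrable_subexponential[OF assms(1,2)]] assms(3,4)
  by (simp add: moment_def)

lemma moment_nonneg: "(\<And>\<omega>. h \<omega> \<ge> 0) \<Longrightarrow> moment h \<beta> \<ge> 0"
  by (simp add: moment_def)

lemma Z_pos:
  assumes "\<beta> \<in> \<Theta>"
  shows "Z \<beta> > 0"
proof (rule ccontr)
  assume "\<not> Z \<beta> > 0"
  then have "Z \<beta> = 0" using moment_nonneg[of "\<lambda>_. 1" \<beta>] by simp
  then have "AE \<omega> in M. False"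
    using moment_eq_0[OF assms subexponential_const, of 1] by simp
  then have "AE \<omega> in M. 1 + (0::real^'n) \<bullet> T \<omega> = 0" by (rule AE_mp) simp
  then show False using linearly_independent(1) by fastforce
qed

text \<open>The expectation under the distribution with parameter \<open>\<beta>\<close>, see \<open>integral_prob_at\<close> below.\<close>

definition mean :: "('a \<Rightarrow> real) \<Rightarrow> real^'n \<Rightarrow> real" where
  "mean h \<beta> = moment h \<beta> / Z \<beta>"

lemma smooth_mean: "subexponential h \<Longrightarrow> smooth_on \<Theta> (mean h)"
  unfolding mean_def[abs_def]
  by (rule smooth_on_divide[OF open_\<Theta> smooth_moment smooth_moment[OF subexponential_const]])
     (use Z_pos in force)+

lemma mean_const: "\<beta> \<in> \<Theta> \<Longrightarrow> mean (\<lambda>_. c) \<beta> = c"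
  using moment_cmult[of c "\<lambda>_. 1" \<beta>] Z_pos[of \<beta>] by (simp add: mean_def)

lemma mean_cmult: "mean (\<lambda>\<omega>. c * f \<omega>) \<beta> = c * mean f \<beta>"
  by (simp add: mean_def moment_cmult)

lemma mean_add:
  "\<lbrakk>\<beta> \<in> \<Theta>; subexponential f; subexponential h\<rbrakk> \<Longrightarrow> mean (\<lambda>\<omega>. f \<omega> + h \<omega>) \<beta> = mean f \<beta> + mean h \<beta>"
  by (simp add: mean_def moment_add add_divide_distrib)

lemma mean_diff:
  "\<lbrakk>\<beta> \<in> \<Theta>; subexponential f; subexponential h\<rbrakk> \<Longrightarrow> mean (\<lambda>\<omega>. f \<omega> - h \<omega>) \<beta> = mean f \<beta> - mean h \<beta>"
  using mean_add[of \<beta> f "\<lambda>\<omega>. (-1) * h \<omega>"] mean_cmult[of "-1" h \<beta>]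
    subexponential_mult[OF subexponential_const[of "-1"], of h] by simp

text \<open>Minus the covariance of \<open>h\<close> and $v \cdot T$. Starting from \<open>\<psi>\<close>, whose derivative is minus the mean
  of $v \cdot T$, this rule produces the metric and the skewness tensor.\<close>

lemma pd_mean:
  assumes "\<beta> \<in> \<Theta>" "subexponential h"
  shows "pd v (mean h) \<beta> = mean (\<lambda>\<omega>. v \<bullet> T \<omega>) \<beta> * mean h \<beta> - mean (\<lambda>\<omega>. (v \<bullet> T \<omega>) * h \<omega>) \<beta>"
proof -
  have nz: "Z \<beta> \<noteq> 0" using Z_pos[OF assms(1)] by simp
  have d: "moment f differentiable (at \<beta>)" if "subexponential f" for f
    using moment_has_derivative[OF assms(1) that] differentiableI by blast
  have "pd v (mean h) \<beta> = pd v (\<lambda>\<beta>. moment h \<beta> * inverse (Z \<beta>)) \<beta>"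
    by (rule arg_cong[where f = "\<lambda>f. pd v f \<beta>"]) (simp add: fun_eq_iff mean_def divide_inverse)
  also have "\<dots> = moment h \<beta> * pd v (\<lambda>\<beta>. inverse (Z \<beta>)) \<beta> + pd v (moment h) \<beta> * inverse (Z \<beta>)"
    by (rule pd_bounded_bilinear[OF bounded_bilinear_mult d[OF assms(2)]
          pd_inverse(2)[OF d[OF subexponential_const] nz]])
  also have "\<dots> = moment h \<beta> * (moment (\<lambda>\<omega>. v \<bullet> T \<omega>) \<beta> * (inverse (Z \<beta>) * inverse (Z \<beta>)))
      - moment (\<lambda>\<omega>. (v \<bullet> T \<omega>) * h \<omega>) \<beta> * inverse (Z \<beta>)"
    using pd_inverse(1)[OF d[OF subexponential_const] nz]
    by (simp add: pd_moment[OF assms] pd_moment[OF assms(1) subexponential_const])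
  finally show ?thesis by (simp add: mean_def divide_inverse mult_ac)
qed

abbreviation \<psi> :: "real^'n \<Rightarrow> real" where
  "\<psi> \<equiv> log_partition M X"

lemma log_partition_eq: "\<psi> \<beta> = ln (Z \<beta>)"
  by (simp add: log_partition_def moment_def inner_T)

lemma log_partition_has_derivative:
  assumes "\<beta> \<in> \<Theta>"
  shows "(\<psi> has_derivative (\<lambda>v. - mean (\<lambda>\<omega>. v \<bullet> T \<omega>) \<beta>)) (at \<beta>)"
proof -
  have "\<psi> = (\<lambda>\<beta>. ln (Z \<beta>))" by (simp add: fun_eq_iff log_partition_eq)
  then show ?thesis
    using has_derivative_ln[OF Z_pos[OF assms] moment_has_derivative[OF assms subexponential_const]]
    by (simp add: mean_def divide_inverse mult.commute)
qed

lemma pd_log_partition: "\<beta> \<in> \<Theta> \<Longrightarrow> pd v \<psi> \<beta> = - mean (\<lambda>\<omega>. v \<bullet> T \<omega>) \<beta>"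
  by (rule pd_eqI[OF log_partition_has_derivative])

lemma smooth_log_partition: "smooth_on \<Theta> \<psi>"
proof (rule smooth_onI)
  show "\<psi> differentiable (at \<beta>)" if "\<beta> \<in> \<Theta>" for \<beta>
    by (rule differentiableI[OF log_partition_has_derivative[OF that]])
  show "smooth_on \<Theta> (pd v \<psi>)" for v
    using smooth_on_cong[OF open_\<Theta> smooth_on_minus[OF open_\<Theta> smooth_mean[OF subexponential_inner_T]]]
    by (simp add: pd_log_partition)
qed

lemma pd_pd_log_partition:
  assumes "\<beta> \<in> \<Theta>"
  shows "pd u (pd v \<psi>) \<beta> = mean (\<lambda>\<omega>. (u \<bullet> T \<omega>) * (v \<bullet> T \<omega>)) \<beta>
    - mean (\<lambda>\<omega>. u \<bullet> T \<omega>) \<beta> * mean (\<lambda>\<omega>. v \<bullet> T \<omega>) \<beta>"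
proof -
  have "pd u (pd v \<psi>) \<beta> = pd u (\<lambda>\<beta>. - mean (\<lambda>\<omega>. v \<bullet> T \<omega>) \<beta>) \<beta>"
    by (simp add: frechet_derivative_cong_open[OF open_\<Theta> assms pd_log_partition])
  also have "\<dots> = - pd u (mean (\<lambda>\<omega>. v \<bullet> T \<omega>)) \<beta>"
    using smooth_on_differentiable[OF smooth_mean assms] subexponential_inner_T
    by (intro pd_bounded_linear[OF bounded_linear_minus[OF bounded_linear_ident]]) blast
  finally show ?thesis by (simp add: pd_mean[OF assms subexponential_inner_T])
qed

lemma pd_pd_pd_log_partition:
  fixes u v w :: "real^'n"
  assumes \<beta>: "\<beta> \<in> \<Theta>"
  defines "E \<equiv> \<lambda>h. mean h \<beta>"
  shows "pd u (pd v (pd w \<psi>)) \<beta> =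
    E (\<lambda>\<omega>. u \<bullet> T \<omega>) * E (\<lambda>\<omega>. (v \<bullet> T \<omega>) * (w \<bullet> T \<omega>)) - E (\<lambda>\<omega>. (u \<bullet> T \<omega>) * ((v \<bullet> T \<omega>) * (w \<bullet> T \<omega>)))
    - (E (\<lambda>\<omega>. u \<bullet> T \<omega>) * E (\<lambda>\<omega>. v \<bullet> T \<omega>) - E (\<lambda>\<omega>. (u \<bullet> T \<omega>) * (v \<bullet> T \<omega>))) * E (\<lambda>\<omega>. w \<bullet> T \<omega>)
    - E (\<lambda>\<omega>. v \<bullet> T \<omega>) * (E (\<lambda>\<omega>. u \<bullet> T \<omega>) * E (\<lambda>\<omega>. w \<bullet> T \<omega>) - E (\<lambda>\<omega>. (u \<bullet> T \<omega>) * (w \<bullet> T \<omega>)))"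
proof -
  let ?vw = "mean (\<lambda>\<omega>. (v \<bullet> T \<omega>) * (w \<bullet> T \<omega>))" and ?v = "mean (\<lambda>\<omega>. v \<bullet> T \<omega>)" and ?w = "mean (\<lambda>\<omega>. w \<bullet> T \<omega>)"
  have s: "subexponential (\<lambda>\<omega>. (v \<bullet> T \<omega>) * (w \<bullet> T \<omega>))" by (intro subexponential_intros)
  have "pd u (pd v (pd w \<psi>)) \<beta> = pd u (\<lambda>\<beta>. ?vw \<beta> - ?v \<beta> * ?w \<beta>) \<beta>"
    by (simp add: frechet_derivative_cong_open[OF open_\<Theta> \<beta> pd_pd_log_partition])
  also have "\<dots> = pd u ?vw \<beta> - (?v \<beta> * pd u ?w \<beta> + pd u ?v \<beta> * ?w \<beta>)"
    by (rule pd_eqI)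
       (intro has_derivative_diff has_derivative_mult has_frechet_derivative
          smooth_on_differentiable[OF smooth_mean \<beta>] s subexponential_inner_T)
  finally show ?thesis
    by (simp add: pd_mean[OF \<beta>] s subexponential_inner_T E_def)
qed

lemma rho_eq: "\<beta> \<in> \<Theta> \<Longrightarrow> rho M X \<beta> \<omega> = exp (- (\<beta> \<bullet> T \<omega>)) / Z \<beta>"
  using Z_pos[of \<beta>] exp_diff[of "- (\<beta> \<bullet> T \<omega>)" "ln (Z \<beta>)"]
  by (simp add: rho_def log_partition_eq inner_T[symmetric] add.commute)

lemma integral_prob_at:
  assumes "\<beta> \<in> \<Theta>" "h \<in> borel_measurable M"
  shows "(\<integral>\<omega>. h \<omega> \<partial>prob_at M X \<beta>) = mean h \<beta>"
proof -
  have "(\<integral>\<omega>. h \<omega> \<partial>prob_at M X \<beta>) = (\<integral>\<omega>. (exp (- (\<beta> \<bullet> T \<omega>)) / Z \<beta>) *\<^sub>R h \<omega> \<partial>M)"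
    unfolding prob_at_def rho_eq[OF assms(1)] using Z_pos[OF assms(1)] assms(2)
    by (intro integral_density) auto
  also have "\<dots> = (\<integral>\<omega>. h \<omega> * exp (- (\<beta> \<bullet> T \<omega>)) / Z \<beta> \<partial>M)"
    by (simp add: mult.commute)
  finally show ?thesis by (simp add: mean_def moment_def)
qed

lemma score_eq:
  assumes "\<beta> \<in> \<Theta>"
  shows "score M X \<beta> u \<omega> = mean (\<lambda>\<omega>. u \<bullet> T \<omega>) \<beta> - u \<bullet> T \<omega>"
proof -
  have "((\<lambda>\<beta>. - (\<psi> \<beta> + \<beta> \<bullet> T \<omega>)) has_derivative (\<lambda>u. - (- mean (\<lambda>\<omega>. u \<bullet> T \<omega>) \<beta> + u \<bullet> T \<omega>))) (at \<beta>)"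
    by (intro has_derivative_minus has_derivative_add log_partition_has_derivative[OF assms]
          has_derivative_inner_left has_derivative_ident)
  from pd_eqI[OF this] show ?thesis
    by (simp add: score_def rho_def inner_T[symmetric])
qed

lemma subexponential_score: "\<beta> \<in> \<Theta> \<Longrightarrow> subexponential (score M X \<beta> u)"
  by (subst ext[of "score M X \<beta> u", OF score_eq]) (auto intro: subexponential_intros)

lemma fisher_rao_mean:
  "\<beta> \<in> \<Theta> \<Longrightarrow> fisher_rao M X \<beta> u v = mean (\<lambda>\<omega>. score M X \<beta> u \<omega> * score M X \<beta> v \<omega>) \<beta>"
  unfolding fisher_rao_def
  by (intro integral_prob_at subexponential_measurable subexponential_mult subexponential_score)

lemma skewness_mean:
  "\<beta> \<in> \<Theta> \<Longrightarrow> skewness M X \<beta> u v w = mean (\<lambda>\<omega>. score M X \<beta> u \<omega> * score M X \<beta> v \<omega> * score M X \<beta> w \<omega>) \<beta>"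
  unfolding skewness_def
  by (intro integral_prob_at subexponential_measurable subexponential_mult subexponential_score)

lemma fisher_rao_eq:
  assumes \<beta>: "\<beta> \<in> \<Theta>"
  shows "fisher_rao M X \<beta> u v = pd u (pd v \<psi>) \<beta>"
proof -
  let ?u = "\<lambda>\<omega>. u \<bullet> T \<omega>" and ?v = "\<lambda>\<omega>. v \<bullet> T \<omega>"
  let ?a = "mean ?u \<beta>" and ?b = "mean ?v \<beta>"
  have "fisher_rao M X \<beta> u v = mean (\<lambda>\<omega>. ?a * ?b - ?a * ?v \<omega> - ?b * ?u \<omega> + ?u \<omega> * ?v \<omega>) \<beta>"
    unfolding fisher_rao_mean[OF \<beta>] score_eq[OF \<beta>]
    by (rule arg_cong[where f = "\<lambda>h. mean h \<beta>"]) (simp add: fun_eq_iff algebra_simps)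
  also have "\<dots> = ?a * ?b - ?a * ?b - ?b * ?a + mean (\<lambda>\<omega>. ?u \<omega> * ?v \<omega>) \<beta>"
    by (simp only: mean_add[OF \<beta>] mean_diff[OF \<beta>] mean_cmult mean_const[OF \<beta>] subexponential_intros)
  finally show ?thesis by (simp add: pd_pd_log_partition[OF \<beta>])
qed

lemma skewness_eq:
  assumes \<beta>: "\<beta> \<in> \<Theta>"
  shows "skewness M X \<beta> u v w = pd u (pd v (pd w \<psi>)) \<beta>"
proof -
  let ?u = "\<lambda>\<omega>. u \<bullet> T \<omega>" and ?v = "\<lambda>\<omega>. v \<bullet> T \<omega>" and ?w = "\<lambda>\<omega>. w \<bullet> T \<omega>"
  let ?a = "mean ?u \<beta>" and ?b = "mean ?v \<beta>" and ?c = "mean ?w \<beta>"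
  have "skewness M X \<beta> u v w = mean (\<lambda>\<omega>. ?a * ?b * ?c - ?a * ?b * ?w \<omega> - ?a * ?c * ?v \<omega> - ?b * ?c * ?u \<omega>
      + ?a * (?v \<omega> * ?w \<omega>) + ?b * (?u \<omega> * ?w \<omega>) + ?c * (?u \<omega> * ?v \<omega>) - ?u \<omega> * (?v \<omega> * ?w \<omega>)) \<beta>"
    unfolding skewness_mean[OF \<beta>] score_eq[OF \<beta>]
    by (rule arg_cong[where f = "\<lambda>h. mean h \<beta>"]) (simp add: fun_eq_iff algebra_simps)
  also have "\<dots> = ?a * ?b * ?c - ?a * ?b * ?c - ?a * ?c * ?b - ?b * ?c * ?a
      + ?a * mean (\<lambda>\<omega>. ?v \<omega> * ?w \<omega>) \<beta> + ?b * mean (\<lambda>\<omega>. ?u \<omega> * ?w \<omega>) \<beta> + ?c * mean (\<lambda>\<omega>. ?u \<omega> * ?v \<omega>) \<beta>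
      - mean (\<lambda>\<omega>. ?u \<omega> * (?v \<omega> * ?w \<omega>)) \<beta>"
    by (simp only: mean_add[OF \<beta>] mean_diff[OF \<beta>] mean_cmult mean_const[OF \<beta>] subexponential_intros)
  finally show ?thesis by (simp add: pd_pd_pd_log_partition[OF \<beta>] algebra_simps)
qed

text \<open>A tangent vector of length zero has a score that vanishes almost everywhere, that is, an affine
  relation between the statistics.\<close>

lemma fisher_rao_pos:
  assumes \<beta>: "\<beta> \<in> \<Theta>" and "u \<noteq> 0"
  shows "fisher_rao M X \<beta> u u > 0"
proof (rule ccontr)
  let ?s = "\<lambda>\<omega>. score M X \<beta> u \<omega> * score M X \<beta> u \<omega>"
  assume "\<not> fisher_rao M X \<beta> u u > 0"
  moreover have "moment ?s \<beta> \<ge> 0" by (rule moment_nonneg) simp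
  ultimately have "moment ?s \<beta> = 0"
    using Z_pos[OF \<beta>] by (simp add: fisher_rao_mean[OF \<beta>] mean_def divide_le_0_iff zero_less_divide_iff not_less)
  then have "AE \<omega> in M. ?s \<omega> = 0"
    by (intro moment_eq_0[OF \<beta>] subexponential_mult subexponential_score[OF \<beta>]) simp_all
  then have "AE \<omega> in M. mean (\<lambda>\<omega>. u \<bullet> T \<omega>) \<beta> + (- u) \<bullet> T \<omega> = 0"
    by (rule AE_mp) (simp add: score_eq[OF \<beta>])
  then show False using linearly_independent(2) \<open>u \<noteq> 0\<close> by fastforce
qed

text \<open>The signs agree in every order: the canonical parameters enter with a minus sign, and so do the
  statistics in the scores.\<close>

sublocale hessian_structure \<Theta> \<psi> "fisher_rao M X" "skewness M X" "stat_product M X"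
  by unfold_locales
     (rule open_\<Theta> smooth_log_partition fisher_rao_eq skewness_eq fisher_rao_pos stat_product_def; assumption)+

lemma structure_connection_eq: "structure_connection M X \<alpha> = alpha_connection \<alpha>"
  by (intro ext) (simp add: structure_connection_def alpha_connection_def)

lemma statistical_frobenius:
  "\<alpha> = 1 \<or> \<alpha> = -1 \<Longrightarrow> statistical_frobenius M X \<alpha>"
  unfolding statistical_frobenius_def structure_connection_eq by (rule frobenius_alpha_connection)

lemma statistical_frobenius_iff:
  "\<not> flat_on \<Theta> (levi_civita (fisher_rao M X)) \<Longrightarrow> statistical_frobenius M X \<alpha> \<longleftrightarrow> \<alpha> = 1 \<or> \<alpha> = -1"
  unfolding statistical_frobenius_def structure_connection_eq by (rule frobenius_alpha_connection_iff)

lemma mean_cong_AE: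
  assumes "AE \<omega> in M. f \<omega> = h \<omega>" "f \<in> borel_measurable M" "h \<in> borel_measurable M"
  shows "mean f \<beta> = mean h \<beta>"
proof -
  have "moment f \<beta> = moment h \<beta>"
    unfolding moment_def by (rule integral_cong_AE) (use assms in \<open>auto elim: AE_mp\<close>)
  then show ?thesis by (simp add: mean_def)
qed

lemma mean_score:
  assumes "\<beta> \<in> \<Theta>"
  shows "mean (score M X \<beta> u) \<beta> = 0"
  using mean_diff[OF assms subexponential_const subexponential_inner_T]
  by (subst ext[of "score M X \<beta> u", OF score_eq[OF assms]]) (simp add: mean_const[OF assms])

text \<open>On a finite set of atoms this says that the family is the full open simplex of positive
  distributions.\<close>

definition complete_scores :: "real^'n \<Rightarrow> bool" where
  "complete_scores \<beta> \<longleftrightarrow>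
    (\<forall>f. subexponential f \<longrightarrow> mean f \<beta> = 0 \<longrightarrow> (\<exists>u. AE \<omega> in M. score M X \<beta> u \<omega> = f \<omega>))"

text \<open>The product of tangent vectors is in general the orthogonal projection to the tangent space of
  the product of their scores. When the tangent space is everything centred, the projection only
  subtracts the mean.\<close>

lemma score_product:
  assumes \<beta>: "\<beta> \<in> \<Theta>" and complete: "complete_scores \<beta>"
  shows "AE \<omega> in M. score M X \<beta> (stat_product M X \<beta> u v) \<omega> =
    score M X \<beta> u \<omega> * score M X \<beta> v \<omega> - fisher_rao M X \<beta> u v"
proof -
  let ?s = "score M X \<beta>" and ?g = "fisher_rao M X \<beta>"
  let ?f = "\<lambda>\<omega>. ?s u \<omega> * ?s v \<omega> - ?g u v"
  note s = subexponential_score[OF \<beta>]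
  have uv: "subexponential (\<lambda>\<omega>. ?s u \<omega> * ?s v \<omega>)" by (rule subexponential_mult[OF s s])
  have f: "subexponential ?f" by (rule subexponential_diff[OF uv subexponential_const])
  have "mean ?f \<beta> = 0"
    using mean_diff[OF \<beta> uv subexponential_const] by (simp add: mean_const[OF \<beta>] fisher_rao_mean[OF \<beta>])
  then obtain u' where u': "AE \<omega> in M. ?s u' \<omega> = ?f \<omega>"
    using complete f unfolding complete_scores_def by blast
  have "u' = stat_product M X \<beta> u v"
  proof (rule metric_eqD[OF \<beta>])
    fix w
    have "?g u' w = mean (\<lambda>\<omega>. ?s u \<omega> * ?s v \<omega> * ?s w \<omega> - ?g u v * ?s w \<omega>) \<beta>"
      unfolding fisher_rao_mean[OF \<beta>, of u' w]
    proof (rule mean_cong_AE)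
      show "AE \<omega> in M. ?s u' \<omega> * ?s w \<omega> = ?s u \<omega> * ?s v \<omega> * ?s w \<omega> - ?g u v * ?s w \<omega>"
        using u' by eventually_elim (simp add: left_diff_distrib)
    qed (intro subexponential_measurable subexponential_diff subexponential_mult subexponential_const s)+
    also have "\<dots> = skewness M X \<beta> u v w"
      unfolding skewness_mean[OF \<beta>]
      by (subst mean_diff[OF \<beta>])
         (auto intro!: subexponential_mult subexponential_const s simp: mean_cmult mean_score[OF \<beta>])
    finally show "?g u' w = ?g (stat_product M X \<beta> u v) w" by (simp add: metric_product[OF \<beta>])
  qed
  then show ?thesis using u' by simp
qed

text \<open>By \<open>score_product\<close>, the scores of $u\circ(v\circ v)$ and $v\circ(u\circ v)$ differ by
  $g(u,v)\,s_v - g(v,v)\,s_u$ up to a constant. In a flat Levi-Civita connection they agree, so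
  $g(v,v)\,u = g(u,v)\,v$, which is impossible for independent \<open>u\<close> and \<open>v\<close>.\<close>

lemma not_flat_if_complete_scores:
  assumes \<beta>: "\<beta> \<in> \<Theta>" and complete: "complete_scores \<beta>" and "2 \<le> CARD('n)"
  shows "\<not> flat_on \<Theta> (levi_civita (fisher_rao M X))"
proof
  assume flat: "flat_on \<Theta> (levi_civita (fisher_rao M X))"
  let ?s = "score M X \<beta>" and ?g = "fisher_rao M X \<beta>" and ?m = "stat_product M X \<beta>"
  obtain i j :: 'n where "i \<noteq> j"
    using \<open>2 \<le> CARD('n)\<close> card_le_Suc0_iff_eq[of "UNIV :: 'n set"] by fastforce
  define u v :: "real^'n" where "u = axis i 1" and "v = axis j 1"
  let ?mean = "\<lambda>u. mean (\<lambda>\<omega>. u \<bullet> T \<omega>) \<beta>"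
  define u' where "u' = ?g v v *\<^sub>R u - ?g u v *\<^sub>R v"
  \<comment> \<open>The constant \<open>c\<close> collects the means that centre the scores.\<close>
  define c where "c = ?g v v * ?mean u - ?g u v * ?mean v + ?g u (?m v v) - ?g v (?m u v)"
  have "?m u (?m v v) = ?m v (?m u v)" by (rule flat_levi_civitaD[OF flat \<beta>])
  then have "AE \<omega> in M. ?s (?m v (?m u v)) \<omega> = ?s u \<omega> * ?s (?m v v) \<omega> - ?g u (?m v v)"
    using score_product[OF \<beta> complete, of u "?m v v"] by simp
  then have "AE \<omega> in M. c + (- u') \<bullet> T \<omega> = 0"
    using score_product[OF \<beta> complete, of v "?m u v"] score_product[OF \<beta> complete, of v v]
      score_product[OF \<beta> complete, of u v]
  proof eventually_elim
    case (elim \<omega>)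
    have "?s u \<omega> * (?s v \<omega> * ?s v \<omega> - ?g v v) - ?g u (?m v v)
        = ?s v \<omega> * (?s u \<omega> * ?s v \<omega> - ?g u v) - ?g v (?m u v)"
      using elim by simp
    then have "?g v v * ?s u \<omega> - ?g u v * ?s v \<omega> + ?g u (?m v v) - ?g v (?m u v) = 0"
      by (simp add: algebra_simps)
    then show ?case
      by (simp add: score_eq[OF \<beta>] u'_def c_def inner_diff_left algebra_simps)
  qed
  then have "u' = 0" using linearly_independent(2) by fastforce
  then have "u' $ i = 0" by simp
  moreover have "u $ i = 1" "v $ i = 0" using \<open>i \<noteq> j\<close> by (simp_all add: u_def v_def axis_def)
  ultimately have "?g v v = 0" by (simp add: u'_def)
  moreover have "?g v v > 0" by (rule fisher_rao_pos[OF \<beta>]) (simp add: v_def)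
  ultimately show False by simp
qed

end

section \<open>The family of all positive distributions on a finite set\<close>

text \<open>Counting measure on \<open>n + 1\<close> points, with the indicators of all points but one as statistics. The
  point \<open>0\<close> without a statistic is the one that normalization accounts for.\<close>

lemma non_flat_exponential_family:
  assumes "2 \<le> CARD('n::finite)"
  shows "\<exists>(N :: nat measure) (Y :: 'n \<Rightarrow> nat \<Rightarrow> real). exponential_family N Y \<and>
    \<not> flat_on (parameters N Y) (levi_civita (fisher_rao N Y))"
proof -
  obtain f :: "'n \<Rightarrow> nat" where f: "inj f"
    using finite_imp_inj_to_nat_seg[of "UNIV :: 'n set"] by auto
  define h where "h j = Suc (f j)" for j
  have h: "h i = h j \<longleftrightarrow> i = j" for i j using f by (simp add: h_def inj_eq)
  define A where "A = insert 0 (range h)"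
  have A: "finite A" by (simp add: A_def)
  define N where "N = count_space A"
  define Y :: "'n \<Rightarrow> nat \<Rightarrow> real" where "Y j k = (if k = h j then 1 else 0)" for j k
  have sum0: "(\<Sum>j\<in>UNIV. c $ j * Y j 0) = 0" for c :: "real^'n"
    by (simp add: Y_def h_def)
  have sumh: "(\<Sum>j\<in>UNIV. c $ j * Y j (h i)) = c $ i" for c :: "real^'n" and i
    by (simp add: Y_def h if_distrib[where f = "(*) _"] cong: if_cong)
  have AE_N: "(AE k in N. P k) \<longleftrightarrow> (\<forall>k\<in>A. P k)" for P
    unfolding N_def by (rule AE_count_space)
  have meas: "q \<in> borel_measurable N" for q :: "nat \<Rightarrow> real" by (simp add: N_def)
  have params: "parameters N Y = UNIV"
    using A by (simp add: parameters_def natural_domain_def N_def integrable_count_space)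
  have fam: "exponential_family N Y"
    unfolding exponential_family_def
  proof (intro conjI allI impI)
    show "sigma_finite_measure N" unfolding N_def by (rule sigma_finite_measure_count_space_finite[OF A])
    fix c\<^sub>0 and c :: "real^'n"
    assume "AE k in N. c\<^sub>0 + (\<Sum>j\<in>UNIV. c $ j * Y j k) = 0"
    then have *: "c\<^sub>0 + (\<Sum>j\<in>UNIV. c $ j * Y j k) = 0" if "k \<in> A" for k using that by (simp add: AE_N)
    show "c\<^sub>0 = 0" using *[of 0] sum0[of c] by (simp add: A_def)
    then show "c = 0" using *[of "h _"] sumh[of c] by (simp add: A_def vec_eq_iff)
  qed (simp_all add: meas params)
  interpret exp_family N Y by (unfold_locales) (rule fam)
  have "complete_scores 0"
    unfolding complete_scores_def
  proof (intro allI impI)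
    fix q assume q: "subexponential q" "mean q 0 = 0"
    have 0: "0 \<in> parameters N Y" by (simp add: params)
    \<comment> \<open>The values of \<open>u \<bullet> T\<close> at \<open>0\<close> and at \<open>h j\<close> are \<open>0\<close> and \<open>u $ j\<close>, so this is the only way to get
    \<open>u \<bullet> T = q 0 - q\<close>.\<close>
    define u :: "real^'n" where "u = (\<chi> j. q 0 - q (h j))"
    have u: "u \<bullet> T k = q 0 - q k" if "k \<in> A" for k
      using that sum0[of u] sumh[of u] by (auto simp: A_def inner_T u_def)
    have "mean (\<lambda>k. u \<bullet> T k) 0 = mean (\<lambda>k. q 0 - q k) 0"
      by (rule mean_cong_AE[OF _ meas meas]) (simp add: AE_N u)
    also have "\<dots> = q 0"
      using mean_diff[OF 0 subexponential_const q(1)] q(2) by (simp add: mean_const[OF 0])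
    finally have "AE k in N. score N Y 0 u k = q k"
      by (simp add: AE_N score_eq[OF 0] u)
    then show "\<exists>u. AE k in N. score N Y 0 u k = q k" by blast
  qed
  then show ?thesis
    using not_flat_if_complete_scores[of 0] fam assms params by blast
qed

theorem theorem1:
  fixes M :: "'a measure" and X :: "'n::finite \<Rightarrow> 'a \<Rightarrow> real"
  assumes "exponential_family M X"
  shows "statistical_frobenius M X 1 \<and> statistical_frobenius M X (-1) \<and>
    (\<not> flat_on (parameters M X) (levi_civita (fisher_rao M X)) \<longrightarrow>
      (\<forall>\<alpha>. statistical_frobenius M X \<alpha> \<longleftrightarrow> \<alpha> = 1 \<or> \<alpha> = -1)) \<and>
    (2 \<le> CARD('n) \<longrightarrow>
      (\<exists>(N :: nat measure) (Y :: 'n \<Rightarrow> nat \<Rightarrow> real). exponential_family N Y \<and>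
        (\<forall>\<alpha>. statistical_frobenius N Y \<alpha> \<longleftrightarrow> \<alpha> = 1 \<or> \<alpha> = -1)))"
proof (intro conjI impI)
  interpret exp_family M X by unfold_locales (rule assms)
  show "statistical_frobenius M X 1" "statistical_frobenius M X (-1)"
    by (simp_all add: statistical_frobenius)
  show "\<forall>\<alpha>. statistical_frobenius M X \<alpha> \<longleftrightarrow> \<alpha> = 1 \<or> \<alpha> = -1"
    if "\<not> flat_on (parameters M X) (levi_civita (fisher_rao M X))"
    using statistical_frobenius_iff[OF that] by blast
  assume "2 \<le> CARD('n)"
  then obtain N :: "nat measure" and Y :: "'n \<Rightarrow> nat \<Rightarrow> real" where NY: "exponential_family N Y"
      "\<not> flat_on (parameters N Y) (levi_civita (fisher_rao N Y))"
    using non_flat_exponential_family by blast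
  then show "\<exists>(N :: nat measure) (Y :: 'n \<Rightarrow> nat \<Rightarrow> real). exponential_family N Y \<and>
      (\<forall>\<alpha>. statistical_frobenius N Y \<alpha> \<longleftrightarrow> \<alpha> = 1 \<or> \<alpha> = -1)"
    using exp_family.statistical_frobenius_iff[OF exp_family.intro[OF NY(1)] NY(2)] by blast
qed

end
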